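(* Let $F=C_1+C_2+C_3$ be a singular fiber of Kodaira type $IV$ of an elliptic fibration $g\colon X\to\mathbb P^1$ on a smooth $K3$ surface $X$. Let $R$ be an ADER in $F$. Then $R$ is either of type $A_1$ or of type $A_2$. More precisely, one of the following holds. (1) If $R$ consists of one irreducible component of $F$, then $R$ is of type $A_1$. (2) If $R$ consists of two irreducible components of $F$, then $R$ is of type $A_2$. Conversely, both types occur.
   Context: We work over an algebraically closed field of characteristic $0$. A fiber of Kodaira type $IV$ is $F=C_1+C_2+C_3$, where $C_1,C_2,C_3$ are smooth rational $(-2)$-curves meeting at one common point with distinct tangent directions (and nowhere else). An ADE reduced divisor (ADER) in a singular fiber $F$ is a nonzero reduced subdivisor of $F$ consisting of smooth rational $(-2)$-curves whose dual graph (vertices: components; two vertices joined by as many edges as the intersection number of the two curves) is a disjoint union of Dynkin diagrams of type $A_k$, $D_l$ ($l\ge4$), $E_6,E_7,E_8$. Its type is the type of this graph. *)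

theory Defs
  imports
    "HOL-Analysis.Analysis"
    "HOL-Computational_Algebra.Polynomial"
    "HOL-Library.Function_Algebras"
    "HOL-Library.Multiset"
begin

text \<open>
  Classical (Serre/Hartshorne I) algebraic geometry of locally closed subsets of projective space
  over a field \<open>'k\<close>, meant for \<open>'k\<close> algebraically closed.
  Functions on a subset are represented by total functions on projective space whose values
  outside the relevant open set are irrelevant; so the elements of a local ring below
  are representatives of germs, not germs.
  Sums, products and differences of functions are pointwise (\<^theory>\<open>HOL-Library.Function_Algebras\<close>).
\<close>

interpretation fun_vs: vector_space "\<lambda>(c::'k::field) (f::'x \<Rightarrow> 'k) x. c * f x"
  by unfold_locales (auto simp: plus_fun_def algebra_simps)

text \<open>The dimension of \<open>A/B\<close> for function spaces \<open>B \<subseteq> A\<close>, when it is finite.\<close>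

definition quot_dim :: "('x \<Rightarrow> 'k::field) set \<Rightarrow> ('x \<Rightarrow> 'k) set \<Rightarrow> nat" where
  "quot_dim A B = (LEAST n. \<exists>S. S \<subseteq> A \<and> finite S \<and> card S = n \<and> A \<subseteq> fun_vs.span (B \<union> S))"


section \<open>Projective space, regular functions, morphisms\<close>

text \<open>The projective space of dimension \<open>CARD('n) - 1\<close>: lines through the origin of \<open>'k^'n\<close>.\<close>

typedef (overloaded) ('k::field, 'n::finite) proj =
  "{L :: ('k^'n) set. \<exists>v. v \<noteq> 0 \<and> L = range (\<lambda>c. c *s v)}"
proof -
  have "(vec 1 :: 'k^'n) \<noteq> 0" by (simp add: vec_eq_iff)
  then show ?thesis by blast
qed

definition hcoord :: "('k::field, 'n::finite) proj \<Rightarrow> 'k^'n" where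
  "hcoord p = (SOME v. v \<in> Rep_proj p \<and> v \<noteq> 0)"

text \<open>Homogeneous polynomials of a given degree, as functions (the ground field will be infinite).\<close>

inductive hom_poly :: "nat \<Rightarrow> (('k::field)^('n::finite) \<Rightarrow> 'k) \<Rightarrow> bool" where
  const: "hom_poly 0 (\<lambda>_. c)"
| coord: "hom_poly 1 (\<lambda>v. v $ i)"
| add: "hom_poly d F \<Longrightarrow> hom_poly d G \<Longrightarrow> hom_poly d (\<lambda>v. F v + G v)"
| mult: "hom_poly d F \<Longrightarrow> hom_poly e G \<Longrightarrow> hom_poly (d + e) (\<lambda>v. F v * G v)"

definition zariski :: "('k::field, 'n::finite) proj topology" where
  "zariski = topology_generated_by {{p. F (hcoord p) \<noteq> 0} | F d. hom_poly d F}"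

abbreviation zar :: "('k::field, 'n::finite) proj set \<Rightarrow> ('k, 'n) proj topology" where
  "zar V \<equiv> subtopology zariski V"

definition regular_on :: "('k::field, 'n::finite) proj set \<Rightarrow> (('k, 'n) proj \<Rightarrow> 'k) \<Rightarrow> bool" where
  "regular_on U f \<longleftrightarrow>
     (\<forall>p\<in>U. \<exists>W d F G. openin (zar U) W \<and> p \<in> W \<and> hom_poly d F \<and> hom_poly d G \<and>
        (\<forall>q\<in>W. G (hcoord q) \<noteq> 0 \<and> f q = F (hcoord q) / G (hcoord q)))"

definition morphism ::
    "('k::field, 'n::finite) proj set \<Rightarrow> ('k, 'm::finite) proj set \<Rightarrow> (('k, 'n) proj \<Rightarrow> ('k, 'm) proj) \<Rightarrow> bool" where
  "morphism V W \<phi> \<longleftrightarrow> continuous_map (zar V) (zar W) \<phi> \<and>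
     (\<forall>U f. openin (zar W) U \<and> regular_on U f \<longrightarrow> regular_on {p\<in>V. \<phi> p \<in> U} (f \<circ> \<phi>))"

definition isomorphic_var ::
    "('k::field, 'n::finite) proj set \<Rightarrow> ('k, 'm::finite) proj set \<Rightarrow> bool" where
  "isomorphic_var V W \<longleftrightarrow> (\<exists>\<phi> \<psi>. morphism V W \<phi> \<and> morphism W V \<psi> \<and>
     (\<forall>p\<in>V. \<psi> (\<phi> p) = p) \<and> (\<forall>q\<in>W. \<phi> (\<psi> q) = q))"

definition birational_var ::
    "('k::field, 'n::finite) proj set \<Rightarrow> ('k, 'm::finite) proj set \<Rightarrow> bool" where
  "birational_var V W \<longleftrightarrow> (\<exists>U U'. openin (zar V) U \<and> U \<noteq> {} \<and> openin (zar W) U' \<and> U' \<noteq> {} \<and>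
     isomorphic_var U U')"


section \<open>Dimension, local rings, tangent spaces\<close>

definition irreducible_var :: "('k::field, 'n::finite) proj set \<Rightarrow> bool" where
  "irreducible_var Z \<longleftrightarrow> Z \<noteq> {} \<and>
     (\<forall>A B. closedin (zar Z) A \<and> closedin (zar Z) B \<and> A \<union> B = Z \<longrightarrow> A = Z \<or> B = Z)"

definition projective_variety :: "('k::field, 'n::finite) proj set \<Rightarrow> bool" where
  "projective_variety X \<longleftrightarrow> closedin zariski X \<and> irreducible_var X"

definition var_dim :: "('k::field, 'n::finite) proj set \<Rightarrow> nat" where
  "var_dim V = Sup {r. \<exists>Z :: nat \<Rightarrow> ('k, 'n) proj set.
     (\<forall>i\<le>r. closedin (zar V) (Z i) \<and> irreducible_var (Z i)) \<and> (\<forall>i<r. Z i \<subset> Z (Suc i))}"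

definition local_ring ::
    "('k::field, 'n::finite) proj set \<Rightarrow> ('k, 'n) proj \<Rightarrow> (('k, 'n) proj \<Rightarrow> 'k) set" where
  "local_ring V p = {f. \<exists>U. openin (zar V) U \<and> p \<in> U \<and> regular_on U f}"

definition germ_eq ::
    "('k::field, 'n::finite) proj set \<Rightarrow> ('k, 'n) proj \<Rightarrow> (('k, 'n) proj \<Rightarrow> 'k) \<Rightarrow> (('k, 'n) proj \<Rightarrow> 'k) \<Rightarrow> bool" where
  "germ_eq V p f g \<longleftrightarrow> (\<exists>U. openin (zar V) U \<and> p \<in> U \<and> (\<forall>q\<in>U. f q = g q))"

text \<open>The stalk at \<open>p\<close> of the ideal sheaf of \<open>C \<subseteq> V\<close>.\<close>

definition ideal_at ::
    "('k::field, 'n::finite) proj set \<Rightarrow> ('k, 'n) proj set \<Rightarrow> ('k, 'n) proj \<Rightarrow> (('k, 'n) proj \<Rightarrow> 'k) set" where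
  "ideal_at V C p = {f \<in> local_ring V p. \<exists>U. openin (zar V) U \<and> p \<in> U \<and> (\<forall>q\<in>U \<inter> C. f q = 0)}"

text \<open>
  Zariski tangent space: the point derivations of the local ring, extended by zero to
  functions that do not represent germs.
\<close>

definition tangent_space ::
    "('k::field, 'n::finite) proj set \<Rightarrow> ('k, 'n) proj \<Rightarrow> ((('k, 'n) proj \<Rightarrow> 'k) \<Rightarrow> 'k) set" where
  "tangent_space V p = {\<delta>.
     (\<forall>f. f \<notin> local_ring V p \<longrightarrow> \<delta> f = 0) \<and>
     (\<forall>f\<in>local_ring V p. \<forall>g\<in>local_ring V p.
        (germ_eq V p f g \<longrightarrow> \<delta> f = \<delta> g) \<and>
        \<delta> (f + g) = \<delta> f + \<delta> g \<and>
        \<delta> (f * g) = f p * \<delta> g + g p * \<delta> f) \<and>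
     (\<forall>c. \<forall>f\<in>local_ring V p. \<delta> (\<lambda>q. c * f q) = c * \<delta> f)}"

definition smooth_var :: "('k::field, 'n::finite) proj set \<Rightarrow> bool" where
  "smooth_var V \<longleftrightarrow> (\<forall>p\<in>V. fun_vs.dim (tangent_space V p) = var_dim V)"

text \<open>The image of the tangent space of \<open>C \<subseteq> V\<close> in the tangent space of \<open>V\<close>.\<close>

definition tangent_direction ::
    "('k::field, 'n::finite) proj set \<Rightarrow> ('k, 'n) proj set \<Rightarrow> ('k, 'n) proj \<Rightarrow> ((('k, 'n) proj \<Rightarrow> 'k) \<Rightarrow> 'k) set" where
  "tangent_direction V C p = {\<delta> \<in> tangent_space V p. \<forall>f\<in>ideal_at V C p. \<delta> f = 0}"


section \<open>Differential forms, genus, K3 surfaces\<close>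

text \<open>
  A regular form on a smooth variety is a family of (alternating) forms on the tangent spaces
  that is locally a finite sum of \<open>f du\<close>, respectively \<open>f du \<and> dv\<close>, with \<open>f\<close>, \<open>u\<close>, \<open>v\<close> regular;
  here \<open>du\<close> at \<open>q\<close> is \<open>\<lambda>\<delta>. \<delta> u\<close>.
\<close>

definition regular_1forms ::
    "('k::field, 'n::finite) proj set \<Rightarrow> (('k, 'n) proj \<times> ((('k, 'n) proj \<Rightarrow> 'k) \<Rightarrow> 'k) \<Rightarrow> 'k) set" where
  "regular_1forms V = {\<theta>.
     (\<forall>q \<delta>. q \<notin> V \<or> \<delta> \<notin> tangent_space V q \<longrightarrow> \<theta> (q, \<delta>) = 0) \<and>
     (\<forall>p\<in>V. \<exists>U. \<exists>r::nat. \<exists>f u. openin (zar V) U \<and> p \<in> U \<and>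
        (\<forall>i<r. regular_on U (f i) \<and> regular_on U (u i)) \<and>
        (\<forall>q\<in>U. \<forall>\<delta>\<in>tangent_space V q. \<theta> (q, \<delta>) = (\<Sum>i<r. f i q * \<delta> (u i))))}"

definition regular_2form ::
    "('k::field, 'n::finite) proj set \<Rightarrow>
     (('k, 'n) proj \<Rightarrow> ((('k, 'n) proj \<Rightarrow> 'k) \<Rightarrow> 'k) \<Rightarrow> ((('k, 'n) proj \<Rightarrow> 'k) \<Rightarrow> 'k) \<Rightarrow> 'k) \<Rightarrow> bool" where
  "regular_2form V \<omega> \<longleftrightarrow>
     (\<forall>p\<in>V. \<exists>U. \<exists>r::nat. \<exists>f u v. openin (zar V) U \<and> p \<in> U \<and>
        (\<forall>i<r. regular_on U (f i) \<and> regular_on U (u i) \<and> regular_on U (v i)) \<and>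
        (\<forall>q\<in>U. \<forall>\<delta>\<in>tangent_space V q. \<forall>\<epsilon>\<in>tangent_space V q.
           \<omega> q \<delta> \<epsilon> = (\<Sum>i<r. f i q * (\<delta> (u i) * \<epsilon> (v i) - \<delta> (v i) * \<epsilon> (u i)))))"

text \<open>For a smooth projective curve.\<close>

definition genus :: "('k::field, 'n::finite) proj set \<Rightarrow> nat" where
  "genus E = fun_vs.dim (regular_1forms E)"

text \<open>For a smooth surface: a nowhere vanishing regular 2-form trivialises the canonical bundle.\<close>

definition trivial_canonical :: "('k::field, 'n::finite) proj set \<Rightarrow> bool" where
  "trivial_canonical X \<longleftrightarrow> (\<exists>\<omega>. regular_2form X \<omega> \<and>
     (\<forall>p\<in>X. \<exists>\<delta>\<in>tangent_space X p. \<exists>\<epsilon>\<in>tangent_space X p. \<omega> p \<delta> \<epsilon> \<noteq> 0))"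

text \<open>
  Vanishing of the first cohomology of the structure sheaf. The first Cech cohomology of any cover embeds
  into sheaf cohomology, which is the limit over all covers; finite covers suffice by
  quasi-compactness.
\<close>

definition H1_structure_sheaf_vanishes :: "('k::field, 'n::finite) proj set \<Rightarrow> bool" where
  "H1_structure_sheaf_vanishes X \<longleftrightarrow>
     (\<forall>(r::nat) U f.
        (\<forall>i<r. openin (zar X) (U i)) \<and> (\<Union>i<r. U i) = X \<and>
        (\<forall>i<r. \<forall>j<r. regular_on (U i \<inter> U j) (f i j)) \<and>
        (\<forall>i<r. \<forall>j<r. \<forall>l<r. \<forall>p\<in>U i \<inter> U j \<inter> U l. f i j p + f j l p = f i l p)
        \<longrightarrow> (\<exists>g. (\<forall>i<r. regular_on (U i) (g i)) \<and>
               (\<forall>i<r. \<forall>j<r. \<forall>p\<in>U i \<inter> U j. f i j p = g j p - g i p)))"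

definition smooth_projective_surface :: "('k::field, 'n::finite) proj set \<Rightarrow> bool" where
  "smooth_projective_surface X \<longleftrightarrow> projective_variety X \<and> var_dim X = 2 \<and> smooth_var X"

definition K3_surface :: "('k::field, 'n::finite) proj set \<Rightarrow> bool" where
  "K3_surface X \<longleftrightarrow> smooth_projective_surface X \<and> trivial_canonical X \<and> H1_structure_sheaf_vanishes X"


section \<open>Divisors on a smooth variety\<close>

text \<open>Prime divisors on a surface.\<close>

definition curves_in :: "('k::field, 'n::finite) proj set \<Rightarrow> ('k, 'n) proj set set" where
  "curves_in X = {C. C \<subseteq> X \<and> projective_variety C \<and> var_dim C = 1}"

type_synonym ('k, 'n) divisor = "('k, 'n) proj set \<Rightarrow> int"

definition div_components :: "('k::field, 'n::finite) divisor \<Rightarrow> ('k, 'n) proj set set" where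
  "div_components D = {C. D C \<noteq> 0}"

definition is_divisor :: "('k::field, 'n::finite) proj set \<Rightarrow> ('k, 'n) divisor \<Rightarrow> bool" where
  "is_divisor X D \<longleftrightarrow> finite (div_components D) \<and> div_components D \<subseteq> curves_in X"

definition prime_div :: "('k::field, 'n::finite) proj set \<Rightarrow> ('k, 'n) divisor" where
  "prime_div C = (\<lambda>E. if E = C then 1 else 0)"

text \<open>\<open>f\<close> generates the stalk at \<open>p\<close> of the ideal sheaf of \<open>C\<close>.\<close>

definition local_equation ::
    "('k::field, 'n::finite) proj set \<Rightarrow> ('k, 'n) proj set \<Rightarrow> ('k, 'n) proj \<Rightarrow> (('k, 'n) proj \<Rightarrow> 'k) \<Rightarrow> bool" where
  "local_equation X C p f \<longleftrightarrow> f \<in> ideal_at X C p \<and>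
     (\<forall>g\<in>ideal_at X C p. \<exists>a\<in>local_ring X p. germ_eq X p g (a * f))"

text \<open>Nonzero rational functions on an irreducible \<open>X\<close>; the values off some dense open set are irrelevant.\<close>

definition rational_functions :: "('k::field, 'n::finite) proj set \<Rightarrow> (('k, 'n) proj \<Rightarrow> 'k) set" where
  "rational_functions X = {h. \<exists>U. openin (zar X) U \<and> U \<noteq> {} \<and> regular_on U h \<and> (\<forall>q\<in>U. h q \<noteq> 0)}"

text \<open>
  The order of \<open>h\<close> along \<open>C\<close>: the exponent \<open>m\<close> in \<open>h = (a/b) f\<^sup>m\<close>, where \<open>f\<close> is a local equation of \<open>C\<close>
  at some point of \<open>C\<close> and \<open>a\<close>, \<open>b\<close> are regular there and do not vanish identically on \<open>C\<close>.
  Since \<open>X\<close> is irreducible, the identity of rational functions may be tested on any nonempty open set.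
\<close>

definition ord_along ::
    "('k::field, 'n::finite) proj set \<Rightarrow> ('k, 'n) proj set \<Rightarrow> (('k, 'n) proj \<Rightarrow> 'k) \<Rightarrow> int" where
  "ord_along X C h = (THE m. \<exists>p\<in>C. \<exists>f a b U. local_equation X C p f \<and>
     a \<in> local_ring X p - ideal_at X C p \<and> b \<in> local_ring X p - ideal_at X C p \<and>
     openin (zar X) U \<and> U \<noteq> {} \<and> (\<forall>q\<in>U. f q \<noteq> 0 \<and> b q * h q = a q * f q powi m))"

definition principal_div ::
    "('k::field, 'n::finite) proj set \<Rightarrow> (('k, 'n) proj \<Rightarrow> 'k) \<Rightarrow> ('k, 'n) divisor" where
  "principal_div X h = (\<lambda>C. if C \<in> curves_in X then ord_along X C h else 0)"

definition lin_equiv ::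
    "('k::field, 'n::finite) proj set \<Rightarrow> ('k, 'n) divisor \<Rightarrow> ('k, 'n) divisor \<Rightarrow> bool" where
  "lin_equiv X D D' \<longleftrightarrow> (\<exists>h\<in>rational_functions X. D - D' = principal_div X h)"


section \<open>Intersection numbers on a smooth projective surface\<close>

definition local_intersection ::
    "('k::field, 'n::finite) proj set \<Rightarrow> ('k, 'n) proj set \<Rightarrow> ('k, 'n) proj set \<Rightarrow> ('k, 'n) proj \<Rightarrow> nat" where
  "local_intersection X C D p =
     quot_dim (local_ring X p) {f + g | f g. f \<in> ideal_at X C p \<and> g \<in> ideal_at X D p}"

definition proper_intersection ::
    "('k::field, 'n::finite) proj set \<Rightarrow> ('k, 'n) proj set \<Rightarrow> ('k, 'n) proj set \<Rightarrow> int" where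
  "proper_intersection X C D = (\<Sum>p\<in>C \<inter> D. int (local_intersection X C D p))"

text \<open>
  The self-intersection number is computed by moving one copy of \<open>C\<close> in its linear equivalence class to
  a divisor \<open>D\<close> without component \<open>C\<close>; such a \<open>D\<close> exists, and the number does not depend on it.
\<close>

definition self_intersection ::
    "('k::field, 'n::finite) proj set \<Rightarrow> ('k, 'n) proj set \<Rightarrow> int" where
  "self_intersection X C = (THE m. \<exists>D. is_divisor X D \<and> D C = 0 \<and> lin_equiv X D (prime_div C) \<and>
     m = (\<Sum>E\<in>div_components D. D E * proper_intersection X C E))"

definition intersection_number ::
    "('k::field, 'n::finite) proj set \<Rightarrow> ('k, 'n) proj set \<Rightarrow> ('k, 'n) proj set \<Rightarrow> int" where
  "intersection_number X C D =
     (if C = D then self_intersection X C else proper_intersection X C D)"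

definition smooth_rational_curve :: "('k::field, 'n::finite) proj set \<Rightarrow> ('k, 'n) proj set \<Rightarrow> bool" where
  "smooth_rational_curve X C \<longleftrightarrow> C \<in> curves_in X \<and> smooth_var C \<and>
     birational_var C (UNIV :: ('k, 2) proj set)"

definition smooth_rational_m2_curve :: "('k::field, 'n::finite) proj set \<Rightarrow> ('k, 'n) proj set \<Rightarrow> bool" where
  "smooth_rational_m2_curve X C \<longleftrightarrow> smooth_rational_curve X C \<and> intersection_number X C C = -2"


section \<open>Elliptic fibrations and fibers of type IV\<close>

text \<open>
  The (scheme-theoretic) fiber over \<open>t\<close> as a divisor: the pullback of the point \<open>t\<close>, i.e. the
  multiplicity of a curve in it is the order of the pullback of a local parameter at \<open>t\<close>.
\<close>

definition fiber ::
    "('k::field, 'n::finite) proj set \<Rightarrow> (('k, 'n) proj \<Rightarrow> ('k, 2) proj) \<Rightarrow> ('k, 2) proj \<Rightarrow> ('k, 'n) divisor" where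
  "fiber X g t = (\<lambda>C. if C \<in> curves_in X \<and> g ` C = {t}
     then ord_along X C ((SOME \<tau>. local_equation UNIV {t} t \<tau>) \<circ> g) else 0)"

text \<open>
  A surjective morphism to the projective line whose general fiber is a smooth (irreducible)
  curve of genus one; no section is required.
\<close>

definition elliptic_fibration ::
    "('k::field, 'n::finite) proj set \<Rightarrow> (('k, 'n) proj \<Rightarrow> ('k, 2) proj) \<Rightarrow> bool" where
  "elliptic_fibration X g \<longleftrightarrow> morphism X UNIV g \<and> g ` X = UNIV \<and>
     (\<exists>S. finite S \<and> (\<forall>t. t \<notin> S \<longrightarrow>
        (\<exists>E\<in>curves_in X. fiber X g t = prime_div E \<and> smooth_var E \<and> genus E = 1)))"

definition kodaira_IV ::
    "('k::field, 'n::finite) proj set \<Rightarrow> ('k, 'n) divisor \<Rightarrow>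
     ('k, 'n) proj set \<Rightarrow> ('k, 'n) proj set \<Rightarrow> ('k, 'n) proj set \<Rightarrow> bool" where
  "kodaira_IV X F C1 C2 C3 \<longleftrightarrow>
     F = prime_div C1 + prime_div C2 + prime_div C3 \<and>
     distinct [C1, C2, C3] \<and>
     (\<forall>C\<in>{C1, C2, C3}. smooth_rational_m2_curve X C) \<and>
     (\<exists>p. C1 \<inter> C2 = {p} \<and> C1 \<inter> C3 = {p} \<and> C2 \<inter> C3 = {p} \<and>
        distinct [tangent_direction X C1 p, tangent_direction X C2 p, tangent_direction X C3 p])"


section \<open>Dynkin diagrams and ADE reduced divisors\<close>

datatype dynkin = DynA nat | DynD nat | DynE nat

fun valid_dynkin :: "dynkin \<Rightarrow> bool" where
  "valid_dynkin (DynA k) \<longleftrightarrow> k \<ge> 1"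
| "valid_dynkin (DynD l) \<longleftrightarrow> l \<ge> 4"
| "valid_dynkin (DynE m) \<longleftrightarrow> m \<in> {6, 7, 8}"

fun dynkin_rank :: "dynkin \<Rightarrow> nat" where
  "dynkin_rank (DynA k) = k"
| "dynkin_rank (DynD l) = l"
| "dynkin_rank (DynE m) = m"

text \<open>
  Oriented edges on the vertices \<open>0, \<dots>, dynkin_rank t - 1\<close>. For types D and E the last vertex is attached to
  a chain formed by the others: to the last but one vertex of the chain for type D, and to the third one for
  type E.
\<close>

fun dynkin_arrow :: "dynkin \<Rightarrow> nat \<Rightarrow> nat \<Rightarrow> bool" where
  "dynkin_arrow (DynA k) i j \<longleftrightarrow> j = Suc i \<and> j < k"
| "dynkin_arrow (DynD l) i j \<longleftrightarrow> (j = Suc i \<and> j < l - 1) \<or> (i = l - 3 \<and> j = l - 1)"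
| "dynkin_arrow (DynE m) i j \<longleftrightarrow> (j = Suc i \<and> j < m - 1) \<or> (i = 2 \<and> j = m - 1)"

definition dynkin_edge :: "dynkin \<Rightarrow> nat \<Rightarrow> nat \<Rightarrow> bool" where
  "dynkin_edge t i j \<longleftrightarrow> dynkin_arrow t i j \<or> dynkin_arrow t j i"

text \<open>
  The loop-free multigraph with vertex set \<open>V\<close> and \<open>w x y\<close> edges between distinct \<open>x\<close>, \<open>y\<close> is
  isomorphic to the disjoint union of the Dynkin diagrams in the multiset \<open>T\<close>.
\<close>

definition ade_graph :: "'v set \<Rightarrow> ('v \<Rightarrow> 'v \<Rightarrow> int) \<Rightarrow> dynkin multiset \<Rightarrow> bool" where
  "ade_graph V w T \<longleftrightarrow> (\<forall>t\<in>#T. valid_dynkin t) \<and>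
     (\<exists>ts \<phi>. mset ts = T \<and> bij_betw \<phi> V {(i, v). i < length ts \<and> v < dynkin_rank (ts ! i)} \<and>
        (\<forall>x\<in>V. \<forall>y\<in>V. x \<noteq> y \<longrightarrow>
           w x y = (if fst (\<phi> x) = fst (\<phi> y) \<and> dynkin_edge (ts ! fst (\<phi> x)) (snd (\<phi> x)) (snd (\<phi> y))
                    then 1 else 0)))"

definition has_type ::
    "('k::field, 'n::finite) proj set \<Rightarrow> ('k, 'n) divisor \<Rightarrow> dynkin multiset \<Rightarrow> bool" where
  "has_type X R T \<longleftrightarrow> ade_graph (div_components R) (intersection_number X) T"

definition ADER ::
    "('k::field, 'n::finite) proj set \<Rightarrow> ('k, 'n) divisor \<Rightarrow> ('k, 'n) divisor \<Rightarrow> bool" where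
  "ADER X F R \<longleftrightarrow> is_divisor X R \<and> div_components R \<noteq> {} \<and>
     (\<forall>C. R C \<in> {0, 1} \<and> R C \<le> F C) \<and>
     (\<forall>C\<in>div_components R. smooth_rational_m2_curve X C) \<and>
     (\<exists>T. has_type X R T)"

end

theory Submission
  imports Defs
begin

text \<open>
  Two components of \<open>F\<close> meet only at \<open>p\<close>, with different tangent lines, so their intersection number
  is \<open>1\<close> as soon as their ideals \<open>I\<^sub>C\<close>, \<open>I\<^sub>D\<close> generate the maximal ideal \<open>m\<close> of the local ring of \<open>X\<close> at \<open>p\<close>.
  By Nakayama's lemma it is enough that \<open>m = I\<^sub>C + I\<^sub>D + m\<^sup>2\<close>: otherwise a linear form vanishing on the
  right-hand side gives a nonzero tangent vector common to \<open>C\<close> and \<open>D\<close>, and as both tangent lines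
  are one-dimensional they would coincide. So one component gives \<open>A\<^sub>1\<close>, two give \<open>A\<^sub>2\<close>, and all three
  give a triangle, which Dynkin diagrams, being trees, do not contain.
\<close>

section \<open>Local rings of embedded varieties\<close>

lemma openin_zariski_nonvanishing:
  "hom_poly d F \<Longrightarrow> openin zariski {q. F (hcoord q) \<noteq> 0}"
  unfolding zariski_def by (rule topology_generated_by_Basis) blast

lemma topspace_zariski [simp]: "topspace zariski = UNIV"
proof -
  have "openin zariski {q::('a,'b) proj. (\<lambda>_. 1) (hcoord q) \<noteq> (0::'a)}"
    by (rule openin_zariski_nonvanishing[OF hom_poly.const])
  then show ?thesis using openin_subset by fastforce
qed

lemma openin_zar_nonvanishing:
  assumes "openin (zar V) W" "hom_poly d F"
  shows "openin (zar V) (W \<inter> {q. F (hcoord q) \<noteq> 0})"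
proof -
  obtain T where "openin zariski T" "W = T \<inter> V"
    using assms(1) by (auto simp: openin_subtopology)
  then show ?thesis
    using openin_zariski_nonvanishing[OF assms(2)] unfolding openin_subtopology
    by (intro exI[of _ "T \<inter> {q. F (hcoord q) \<noteq> 0}"]) auto
qed

lemma openin_zar_Int_subset:
  assumes "openin (zar V) U" "C \<subseteq> V"
  shows "openin (zar C) (U \<inter> C)"
  using assms by (auto simp: openin_subtopology)

section \<open>Germs as fractions of homogeneous forms\<close>

lemma hom_poly_coord_power: "hom_poly d (\<lambda>v. v $ j ^ d)"
proof (induction d)
  case 0
  then show ?case using hom_poly.const[of 1] by simp
next
  case (Suc d)
  then show ?case using hom_poly.mult[OF hom_poly.coord[of j] Suc] by simp
qed

text \<open>\<open>regular_on\<close> allows a different fraction near each point, but for a germ at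
  \<open>p\<close> one fraction on one neighbourhood is enough. With \<open>local_ringE\<close> this
  turns the ring operations on germs into arithmetic of fractions.\<close>

lemma local_ringI:
  assumes "openin (zar V) W" "p \<in> W" "hom_poly d F" "hom_poly d G"
    and "\<forall>q\<in>W. G (hcoord q) \<noteq> 0 \<and> f q = F (hcoord q) / G (hcoord q)"
  shows "f \<in> local_ring V p"
proof -
  have "openin (zar W) W" by (simp add: openin_subtopology_refl)
  then have "regular_on W f"
    unfolding regular_on_def using assms(3-5)
    by (intro ballI exI[of _ W] exI[of _ d] exI[of _ F] exI[of _ G] conjI) simp_all
  then show ?thesis using assms(1,2) by (auto simp: local_ring_def)
qed

lemma local_ringE:
  assumes "f \<in> local_ring V p"
  obtains W d F G where "openin (zar V) W" "p \<in> W" "hom_poly d F" "hom_poly d G"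
    "\<forall>q\<in>W. G (hcoord q) \<noteq> 0 \<and> f q = F (hcoord q) / G (hcoord q)"
proof -
  obtain U where U: "openin (zar V) U" "p \<in> U" "regular_on U f"
    using assms by (auto simp: local_ring_def)
  obtain W d F G where W: "openin (zar U) W" "p \<in> W" "hom_poly d F" "hom_poly d G"
    "\<forall>q\<in>W. G (hcoord q) \<noteq> 0 \<and> f q = F (hcoord q) / G (hcoord q)"
    using bspec[OF U(3)[unfolded regular_on_def] U(2)] by (elim exE conjE)
  have "openin (zar V) W"
  proof -
    obtain T where "openin zariski T" "W = T \<inter> U" using W(1) by (auto simp: openin_subtopology)
    moreover obtain S where "openin zariski S" "U = S \<inter> V" using U(1) by (auto simp: openin_subtopology)
    ultimately show ?thesis unfolding openin_subtopology by (intro exI[of _ "T \<inter> S"]) auto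
  qed
  from that[OF this W(2-5)] show ?thesis .
qed

lemma const_in_local_ring:
  assumes "p \<in> V"
  shows "(\<lambda>_. c) \<in> local_ring V p"
proof -
  have "openin (zar V) V" by (simp add: openin_subtopology_refl)
  then show ?thesis
    using assms hom_poly.const[of c] hom_poly.const[of 1]
    by (rule local_ringI) simp
qed

lemma local_ring_add:
  assumes "f \<in> local_ring V p" "g \<in> local_ring V p"
  shows "f + g \<in> local_ring V p"
proof -
  from assms(1) obtain W d F G where 1: "openin (zar V) W" "p \<in> W" "hom_poly d F" "hom_poly d G"
    "\<forall>q\<in>W. G (hcoord q) \<noteq> 0 \<and> f q = F (hcoord q) / G (hcoord q)" by (rule local_ringE)
  from assms(2) obtain W' d' F' G' where 2: "openin (zar V) W'" "p \<in> W'" "hom_poly d' F'" "hom_poly d' G'"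
    "\<forall>q\<in>W'. G' (hcoord q) \<noteq> 0 \<and> g q = F' (hcoord q) / G' (hcoord q)" by (rule local_ringE)
  have "hom_poly (d + d') (\<lambda>v. F v * G' v + G v * F' v)" "hom_poly (d + d') (\<lambda>v. G v * G' v)"
    using 1 2 by (auto intro!: hom_poly.add hom_poly.mult)
  moreover have "openin (zar V) (W \<inter> W')" using 1 2 by auto
  moreover have "p \<in> W \<inter> W'" using 1 2 by auto
  ultimately show ?thesis using 1(5) 2(5)
    by (intro local_ringI[of V "W \<inter> W'" p "d + d'" "\<lambda>v. F v * G' v + G v * F' v" "\<lambda>v. G v * G' v"])
      (simp_all add: plus_fun_def add_frac_eq mult.commute)
qed

lemma local_ring_mult:
  assumes "f \<in> local_ring V p" "g \<in> local_ring V p"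
  shows "f * g \<in> local_ring V p"
proof -
  from assms(1) obtain W d F G where 1: "openin (zar V) W" "p \<in> W" "hom_poly d F" "hom_poly d G"
    "\<forall>q\<in>W. G (hcoord q) \<noteq> 0 \<and> f q = F (hcoord q) / G (hcoord q)" by (rule local_ringE)
  from assms(2) obtain W' d' F' G' where 2: "openin (zar V) W'" "p \<in> W'" "hom_poly d' F'" "hom_poly d' G'"
    "\<forall>q\<in>W'. G' (hcoord q) \<noteq> 0 \<and> g q = F' (hcoord q) / G' (hcoord q)" by (rule local_ringE)
  have "hom_poly (d + d') (\<lambda>v. F v * F' v)" "hom_poly (d + d') (\<lambda>v. G v * G' v)"
    using 1 2 by (auto intro!: hom_poly.mult)
  moreover have "openin (zar V) (W \<inter> W')" using 1 2 by auto
  moreover have "p \<in> W \<inter> W'" using 1 2 by auto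
  ultimately show ?thesis using 1(5) 2(5)
    by (intro local_ringI[of V "W \<inter> W'" p "d + d'" "\<lambda>v. F v * F' v" "\<lambda>v. G v * G' v"])
      (simp_all add: times_fun_def)
qed

text \<open>Numerator and denominator are exchanged where the numerator does not vanish. The product
  is 1 only on that neighbourhood, hence \<open>germ_eq\<close> and not equality.\<close>

lemma local_ring_inverse:
  assumes "f \<in> local_ring V p" "f p \<noteq> 0"
  shows "(\<lambda>q. inverse (f q)) \<in> local_ring V p" "germ_eq V p (f * (\<lambda>q. inverse (f q))) (\<lambda>_. 1)"
proof -
  from assms(1) obtain W d F G where 1: "openin (zar V) W" "p \<in> W" "hom_poly d F" "hom_poly d G"
    "\<forall>q\<in>W. G (hcoord q) \<noteq> 0 \<and> f q = F (hcoord q) / G (hcoord q)" by (rule local_ringE)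
  let ?W = "W \<inter> {q. F (hcoord q) \<noteq> 0}"
  have W: "openin (zar V) ?W" "p \<in> ?W"
    using openin_zar_nonvanishing 1 assms(2) by auto
  show "(\<lambda>q. inverse (f q)) \<in> local_ring V p" using W 1(4,3)
    by (rule local_ringI) (use 1(5) in auto)
  show "germ_eq V p (f * (\<lambda>q. inverse (f q))) (\<lambda>_. 1)" unfolding germ_eq_def using 1 W
    by (intro exI[of _ ?W]) (auto simp: times_fun_def)
qed

lemma local_ring_scale:
  assumes "p \<in> V" "f \<in> local_ring V p"
  shows "(\<lambda>q. c * f q) \<in> local_ring V p"
  using local_ring_mult[OF const_in_local_ring[OF assms(1), of c] assms(2)]
  by (simp add: times_fun_def)

lemma local_ring_diff:
  assumes "p \<in> V" "f \<in> local_ring V p" "g \<in> local_ring V p"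
  shows "f - g \<in> local_ring V p"
proof -
  have "f - g = f + (\<lambda>q. (-1) * g q)" by (auto simp: plus_fun_def)
  then show ?thesis using assms local_ring_add local_ring_scale by metis
qed

lemma local_ring_minus_const:
  assumes "p \<in> V" "f \<in> local_ring V p"
  shows "(\<lambda>q. f q - c) \<in> local_ring V p"
  using local_ring_diff[OF assms const_in_local_ring[OF assms(1)], of c] by (simp add: fun_diff_def)

lemma local_ring_restrict:
  assumes "f \<in> local_ring V p" "C \<subseteq> V" "p \<in> C"
  shows "f \<in> local_ring C p"
proof -
  from assms(1) obtain W d F G where 1: "openin (zar V) W" "p \<in> W" "hom_poly d F" "hom_poly d G"
    "\<forall>q\<in>W. G (hcoord q) \<noteq> 0 \<and> f q = F (hcoord q) / G (hcoord q)" by (rule local_ringE)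
  have "openin (zar C) (W \<inter> C)" "p \<in> W \<inter> C"
    using openin_zar_Int_subset[OF 1(1) assms(2)] 1(2) assms(3) by auto
  then show ?thesis using 1(3,4) by (rule local_ringI) (use 1(5) in auto)
qed

text \<open>Since \<open>hcoord\<close> fixes a representative vector for each point, a fraction
  representing a germ on \<open>C\<close> is already a function on all of projective space, and it
  is regular on \<open>V\<close> where \<open>G\<close> does not vanish. So the restriction of germs
  from \<open>V\<close> to \<open>C\<close> is surjective.\<close>

lemma local_ring_lift:
  assumes "f \<in> local_ring C p" "C \<subseteq> V" "p \<in> C"
  shows "\<exists>g\<in>local_ring V p. germ_eq C p f g"
proof -
  from assms(1) obtain W d F G where 1: "openin (zar C) W" "p \<in> W" "hom_poly d F" "hom_poly d G"
    "\<forall>q\<in>W. G (hcoord q) \<noteq> 0 \<and> f q = F (hcoord q) / G (hcoord q)" by (rule local_ringE)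
  let ?g = "\<lambda>q. F (hcoord q) / G (hcoord q)" and ?U = "V \<inter> {q. G (hcoord q) \<noteq> 0}"
  have "openin (zar V) ?U" using openin_zar_nonvanishing[OF _ 1(4)] openin_subtopology_refl[of zariski V] by auto
  moreover have "p \<in> ?U" using 1 assms by auto
  ultimately have "?g \<in> local_ring V p" using 1(3,4) by (rule local_ringI) simp
  moreover have "germ_eq C p f ?g" unfolding germ_eq_def using 1 by (intro exI[of _ W]) auto
  ultimately show ?thesis by blast
qed

section \<open>Equality of germs and the ideal of a subvariety\<close>

lemma germ_eq_at: "germ_eq V p f g \<Longrightarrow> f p = g p"
  by (auto simp: germ_eq_def)

lemma germ_eq_refl: "p \<in> V \<Longrightarrow> germ_eq V p f f"
  unfolding germ_eq_def by (intro exI[of _ V]) (simp add: openin_subtopology_refl)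

text \<open>Two local equalities hold together on the intersection of their neighbourhoods. Most
  germ identities below come from this rule; when there is only one equality, it is supplied
  twice.\<close>

lemma germ_eq_cong:
  assumes "germ_eq V p f f'" "germ_eq V p g g'" "\<And>q. f q = f' q \<Longrightarrow> g q = g' q \<Longrightarrow> h q = h' q"
  shows "germ_eq V p h h'"
proof -
  obtain U U' where "openin (zar V) U" "p \<in> U" "\<forall>q\<in>U. f q = f' q"
    "openin (zar V) U'" "p \<in> U'" "\<forall>q\<in>U'. g q = g' q"
    using assms unfolding germ_eq_def by blast
  then show ?thesis unfolding germ_eq_def using assms(3) by (intro exI[of _ "U \<inter> U'"]) auto
qed

text \<open>Open subsets of \<open>C\<close> are traces of open subsets of \<open>V\<close>. This
  presents the ideal as the kernel of the restriction of germs to \<open>C\<close>.\<close>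

lemma ideal_at_eq:
  assumes "C \<subseteq> V" "p \<in> C"
  shows "ideal_at V C p = {f \<in> local_ring V p. germ_eq C p f 0}"
proof -
  have "(\<exists>U. openin (zar V) U \<and> p \<in> U \<and> (\<forall>q\<in>U \<inter> C. f q = 0)) \<longleftrightarrow> germ_eq C p f 0" for f :: "('a, 'b) proj \<Rightarrow> 'a"
  proof
    assume "\<exists>U. openin (zar V) U \<and> p \<in> U \<and> (\<forall>q\<in>U \<inter> C. f q = 0)"
    then obtain U where "openin (zar V) U" "p \<in> U" "\<forall>q\<in>U \<inter> C. f q = 0" by blast
    then show "germ_eq C p f 0"
      unfolding germ_eq_def using openin_zar_Int_subset[OF _ assms(1)] assms(2)
      by (intro exI[of _ "U \<inter> C"]) auto
  next
    assume "germ_eq C p f 0"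
    then obtain U where U: "openin (zar C) U" "p \<in> U" "\<forall>q\<in>U. f q = 0" by (auto simp: germ_eq_def)
    then obtain T where "openin zariski T" "U = T \<inter> C" by (auto simp: openin_subtopology)
    then show "\<exists>U. openin (zar V) U \<and> p \<in> U \<and> (\<forall>q\<in>U \<inter> C. f q = 0)" using U assms
      by (intro exI[of _ "T \<inter> V"]) (auto simp: openin_subtopology)
  qed
  then show ?thesis by (auto simp: ideal_at_def)
qed


section \<open>Ideals and Nakayama's lemma\<close>

definition max_ideal :: "('k::field, 'n::finite) proj set \<Rightarrow> ('k, 'n) proj \<Rightarrow> (('k, 'n) proj \<Rightarrow> 'k) set" where
  "max_ideal V p = {f \<in> local_ring V p. f p = 0}"

text \<open>Since elements of the local ring are representatives, an ideal has to contain all representatives of zero.\<close>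

definition germ_ideal :: "('k::field, 'n::finite) proj set \<Rightarrow> ('k, 'n) proj \<Rightarrow> (('k, 'n) proj \<Rightarrow> 'k) set \<Rightarrow> bool" where
  "germ_ideal V p J \<longleftrightarrow> J \<subseteq> local_ring V p \<and>
     (\<forall>f\<in>local_ring V p. germ_eq V p f 0 \<longrightarrow> f \<in> J) \<and>
     (\<forall>f\<in>J. \<forall>g\<in>J. f + g \<in> J) \<and> (\<forall>a\<in>local_ring V p. \<forall>f\<in>J. a * f \<in> J)"

lemma germ_idealD:
  assumes "germ_ideal V p J"
  shows "f \<in> J \<Longrightarrow> f \<in> local_ring V p"
    and "f \<in> local_ring V p \<Longrightarrow> germ_eq V p f 0 \<Longrightarrow> f \<in> J"
    and "f \<in> J \<Longrightarrow> g \<in> J \<Longrightarrow> f + g \<in> J"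
    and "a \<in> local_ring V p \<Longrightarrow> f \<in> J \<Longrightarrow> a * f \<in> J"
  using assms by (auto simp: germ_ideal_def)

lemma germ_ideal_scale:
  assumes "germ_ideal V p J" "p \<in> V" "f \<in> J"
  shows "(\<lambda>q. c * f q) \<in> J"
  using germ_idealD(4)[OF assms(1) const_in_local_ring[OF assms(2), of c] assms(3)]
  by (simp add: times_fun_def)

lemma germ_ideal_zero: "germ_ideal V p J \<Longrightarrow> p \<in> V \<Longrightarrow> 0 \<in> J"
  using germ_idealD(2)[of V p J 0] germ_eq_refl[of p V 0] const_in_local_ring[of p V 0]
  by (simp add: zero_fun_def)

lemma germ_ideal_subspace:
  assumes "germ_ideal V p J" "p \<in> V"
  shows "fun_vs.subspace J"
  using assms germ_ideal_zero germ_ideal_scale germ_idealD(3)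
  by (auto simp: fun_vs.subspace_def)

lemma ideal_at_germ_ideal:
  assumes "C \<subseteq> V" "p \<in> C"
  shows "germ_ideal V p (ideal_at V C p)"
proof -
  have p: "p \<in> V" using assms by auto
  have 1: "germ_eq C p f 0" if "germ_eq V p f 0" for f :: "('a, 'b) proj \<Rightarrow> 'a"
  proof -
    from that obtain U where "openin (zar V) U" "p \<in> U" "\<forall>q\<in>U. f q = 0" by (auto simp: germ_eq_def)
    then show ?thesis unfolding germ_eq_def using openin_zar_Int_subset[OF _ assms(1)] assms(2)
      by (intro exI[of _ "U \<inter> C"]) auto
  qed
  have 2: "germ_eq C p (f + g) 0" if "germ_eq C p f 0" "germ_eq C p g 0" for f g :: "('a, 'b) proj \<Rightarrow> 'a"
    using that by (rule germ_eq_cong) auto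
  have 3: "germ_eq C p (f * g) 0" if "germ_eq C p g 0" for f g :: "('a, 'b) proj \<Rightarrow> 'a"
    using that that by (rule germ_eq_cong) auto
  show ?thesis unfolding ideal_at_eq[OF assms] germ_ideal_def
    using 1 2 3 by (auto intro: local_ring_add local_ring_mult)
qed

lemma germ_ideal_sum:
  assumes "germ_ideal V p I" "germ_ideal V p J" "p \<in> V"
  shows "germ_ideal V p {f + g | f g. f \<in> I \<and> g \<in> J}" (is "germ_ideal V p ?S")
  unfolding germ_ideal_def
proof (intro conjI ballI impI)
  show "?S \<subseteq> local_ring V p"
    using germ_idealD(1)[OF assms(1)] germ_idealD(1)[OF assms(2)] local_ring_add by blast
next
  fix f assume "f \<in> local_ring V p" "germ_eq V p f 0"
  then have "f \<in> I" using germ_idealD(2)[OF assms(1)] by blast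
  moreover have "f = f + 0" by simp
  ultimately show "f \<in> ?S" using germ_ideal_zero[OF assms(2,3)] by blast
next
  fix f g assume "f \<in> ?S" "g \<in> ?S"
  then obtain a b c d where *: "f = a + b" "g = c + d" "a \<in> I" "c \<in> I" "b \<in> J" "d \<in> J" by blast
  have "f + g = (a + c) + (b + d)" by (simp add: * algebra_simps)
  then show "f + g \<in> ?S" using * germ_idealD(3)[OF assms(1)] germ_idealD(3)[OF assms(2)] by blast
next
  fix a f assume a: "a \<in> local_ring V p" and "f \<in> ?S"
  then obtain b c where *: "f = b + c" "b \<in> I" "c \<in> J" by blast
  have "a * f = a * b + a * c" by (simp add: * algebra_simps)
  then show "a * f \<in> ?S" using * a germ_idealD(4)[OF assms(1)] germ_idealD(4)[OF assms(2)] by blast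
qed

lemma germ_ideal_local_ring: "germ_ideal V p (local_ring V p)"
  by (simp add: germ_ideal_def local_ring_add local_ring_mult)

lemma germ_ideal_max_ideal: "germ_ideal V p (max_ideal V p)"
  using germ_eq_at[of V p _ 0]
  by (auto simp: germ_ideal_def max_ideal_def local_ring_add local_ring_mult)

text \<open>With \<open>A\<close> the local ring this is the ideal \<open>J + (u)\<close>; with
  \<open>A\<close> the maximal ideal \<open>m\<close> it is \<open>J + m u\<close>. The proof of
  Nakayama's lemma compares the two.\<close>

definition adjoin :: "('x \<Rightarrow> 'k::field) set \<Rightarrow> ('x \<Rightarrow> 'k) set \<Rightarrow> ('x \<Rightarrow> 'k) \<Rightarrow> ('x \<Rightarrow> 'k) set" where
  "adjoin J A u = {j + a * u | j a. j \<in> J \<and> a \<in> A}"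

lemma adjoinI: "j \<in> J \<Longrightarrow> a \<in> A \<Longrightarrow> f = j + a * u \<Longrightarrow> f \<in> adjoin J A u"
  by (auto simp: adjoin_def)

lemma adjoinE:
  assumes "f \<in> adjoin J A u"
  obtains j a where "f = j + a * u" "j \<in> J" "a \<in> A"
  using assms by (auto simp: adjoin_def)

lemma germ_ideal_subset_adjoin:
  assumes "germ_ideal V p A" "p \<in> V"
  shows "J \<subseteq> adjoin J A u"
proof
  fix f assume "f \<in> J"
  then show "f \<in> adjoin J A u" using germ_ideal_zero[OF assms] by (rule adjoinI) simp
qed

lemma germ_ideal_adjoin:
  assumes J: "germ_ideal V p J" and A: "germ_ideal V p A" and p: "p \<in> V" and u: "u \<in> local_ring V p"
  shows "germ_ideal V p (adjoin J A u)"
  unfolding germ_ideal_def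
proof (intro conjI ballI impI subsetI)
  fix f assume "f \<in> adjoin J A u"
  then obtain j a where "f = j + a * u" "j \<in> J" "a \<in> A" by (rule adjoinE)
  then show "f \<in> local_ring V p"
    using germ_idealD(1)[OF J] germ_idealD(1)[OF A] u by (simp add: local_ring_add local_ring_mult)
next
  fix f assume "f \<in> local_ring V p" "germ_eq V p f 0"
  then have "f \<in> J" by (rule germ_idealD(2)[OF J])
  then show "f \<in> adjoin J A u" using germ_ideal_subset_adjoin[OF A p] by blast
next
  fix f g assume "f \<in> adjoin J A u" "g \<in> adjoin J A u"
  then obtain j a i b where *: "f = j + a * u" "j \<in> J" "a \<in> A" "g = i + b * u" "i \<in> J" "b \<in> A"
    by (elim adjoinE)
  show "f + g \<in> adjoin J A u"
    using germ_idealD(3)[OF J *(2,5)] germ_idealD(3)[OF A *(3,6)]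
    by (rule adjoinI) (simp add: * algebra_simps)
next
  fix c f assume c: "c \<in> local_ring V p" and "f \<in> adjoin J A u"
  then obtain j a where *: "f = j + a * u" "j \<in> J" "a \<in> A" by (elim adjoinE)
  show "c * f \<in> adjoin J A u"
    using germ_idealD(4)[OF J c *(2)] germ_idealD(4)[OF A c *(3)]
    by (rule adjoinI) (simp add: * algebra_simps)
qed

section \<open>Generators of the maximal ideal\<close>

lemma hcoord_nonzero: "\<exists>j. hcoord p $ j \<noteq> 0"
proof -
  obtain v where v: "v \<noteq> 0" "Rep_proj p = range (\<lambda>c. c *s v)" using Rep_proj[of p] by blast
  have "v = 1 *s v" by simp
  then have "v \<in> Rep_proj p \<and> v \<noteq> 0" using v by blast
  then have "hcoord p \<noteq> 0" unfolding hcoord_def by (rule someI2) blast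
  then show ?thesis by (simp add: vec_eq_iff)
qed

text \<open>On an affine chart around \<open>p\<close> the coordinates, shifted to vanish at
  \<open>p\<close>, generate the maximal ideal. Generation is expressed through the germ ideals
  \<open>J\<close> containing \<open>S\<close>, so that no generated ideal has to be
  constructed.\<close>

lemma max_ideal_generators:
  fixes V :: "('k::field, 'n::finite) proj set"
  assumes p: "p \<in> V"
  shows "\<exists>S. finite S \<and> S \<subseteq> max_ideal V p \<and> (\<forall>J. germ_ideal V p J \<and> S \<subseteq> J \<longrightarrow> max_ideal V p \<subseteq> J)"
proof -
  obtain j where j: "hcoord p $ j \<noteq> 0" using hcoord_nonzero by blast
  define u where "u i = (\<lambda>q :: ('k, 'n) proj. hcoord q $ i / hcoord q $ j - hcoord p $ i / hcoord p $ j)" for i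
  \<comment> \<open>Dehomogenisation of a form of degree \<open>d\<close> on the chart where
    coordinate \<open>j\<close> is nonzero.\<close>
  define h where "h F d = (\<lambda>q :: ('k, 'n) proj. F (hcoord q) / hcoord q $ j ^ d)"
    for F :: "'k^'n \<Rightarrow> 'k" and d :: nat
  have h: "h F d \<in> local_ring V p" if "hom_poly d F" for F d
  proof -
    let ?W = "V \<inter> {q. hcoord q $ j \<noteq> 0}"
    have "openin (zar V) ?W"
      using openin_zar_nonvanishing[OF _ hom_poly.coord[of j]] openin_subtopology_refl[of zariski V] by auto
    moreover have "p \<in> ?W" using p j by auto
    ultimately show ?thesis using that hom_poly_coord_power[of d j]
      by (rule local_ringI) (simp add: h_def)
  qed
  have u: "u i \<in> max_ideal V p" for i
    using local_ring_minus_const[OF p h[OF hom_poly.coord[of i]]]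
    by (simp add: max_ideal_def u_def h_def)
  have gen: "max_ideal V p \<subseteq> J" if J: "germ_ideal V p J" and uJ: "range u \<subseteq> J" for J
  proof -
    have hJ: "(\<lambda>q. h F d q - h F d p) \<in> J" if "hom_poly d F" for F d
      using that
    proof induction
      case (const c)
      then show ?case using germ_ideal_zero[OF J p] by (simp add: h_def zero_fun_def)
    next
      case (coord i)
      have "u i \<in> J" using uJ by blast
      then show ?case by (simp add: u_def h_def)
    next
      case (add d F G)
      have "(\<lambda>q. h (\<lambda>v. F v + G v) d q - h (\<lambda>v. F v + G v) d p) =
          (\<lambda>q. h F d q - h F d p) + (\<lambda>q. h G d q - h G d p)"
        by (rule ext) (simp add: h_def add_divide_distrib)
      then show ?case using germ_idealD(3)[OF J add.IH] by simp
    next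
      case (mult d F e G)
      \<comment> \<open>The identity \<open>ab - a(p) b(p) = a (b - b(p)) + b(p) (a - a(p))\<close>
        reduces a product to its factors.\<close>
      have "(\<lambda>q. h (\<lambda>v. F v * G v) (d + e) q - h (\<lambda>v. F v * G v) (d + e) p) =
          h F d * (\<lambda>q. h G e q - h G e p) + (\<lambda>q. h G e p * (h F d q - h F d p))"
        by (rule ext) (simp add: h_def power_add algebra_simps)
      moreover have "h F d * (\<lambda>q. h G e q - h G e p) \<in> J"
        by (rule germ_idealD(4)[OF J h[OF mult.hyps(1)] mult.IH(2)])
      moreover have "(\<lambda>q. h G e p * (h F d q - h F d p)) \<in> J"
        by (rule germ_ideal_scale[OF J p mult.IH(1)])
      ultimately show ?case using germ_idealD(3)[OF J] by simp
    qed
    show ?thesis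
    proof
      fix f assume f: "f \<in> max_ideal V p"
      then have "f \<in> local_ring V p" by (simp add: max_ideal_def)
      then obtain W d F G where W: "openin (zar V) W" "p \<in> W" "hom_poly d F" "hom_poly d G"
        "\<forall>q\<in>W. G (hcoord q) \<noteq> 0 \<and> f q = F (hcoord q) / G (hcoord q)"
        by (rule local_ringE)
      have Fp: "F (hcoord p) = 0" using f W(2,5) by (fastforce simp: max_ideal_def)
      then have FJ: "h F d \<in> J" using hJ[OF W(3)] by (simp add: h_def)
      have G: "h G d \<in> local_ring V p" "h G d p \<noteq> 0" using h[OF W(4)] W(2,5) j by (auto simp: h_def)
      \<comment> \<open>Near \<open>p\<close> the powers of coordinate \<open>j\<close> cancel and
        \<open>a\<close> is \<open>F / G\<close>, that is \<open>f\<close>. It lies in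
        \<open>J\<close> because \<open>h F d\<close> does, the other factor being regular at
        \<open>p\<close>.\<close>
      define a where "a = (\<lambda>q. inverse (h G d q)) * h F d"
      have aJ: "a \<in> J" unfolding a_def using germ_idealD(4)[OF J local_ring_inverse(1)[OF G] FJ] .
      have "germ_eq V p (f - a) 0"
      proof -
        let ?W = "W \<inter> {q. hcoord q $ j \<noteq> 0}"
        have "openin (zar V) ?W" using openin_zar_nonvanishing[OF W(1) hom_poly.coord[of j]] .
        moreover have "p \<in> ?W" using W(2) j by simp
        moreover have "(f - a) q = 0 q" if "q \<in> ?W" for q
          using that W(5) by (simp add: a_def h_def)
        ultimately show ?thesis unfolding germ_eq_def by blast
      qed
      moreover have "f - a \<in> local_ring V p"
        using f germ_idealD(1)[OF J aJ] local_ring_diff[OF p] by (auto simp: max_ideal_def)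
      ultimately have "f - a \<in> J" using germ_idealD(2)[OF J] by blast
      then have "(f - a) + a \<in> J" using aJ germ_idealD(3)[OF J] by blast
      then show "f \<in> J" by simp
    qed
  qed
  show ?thesis using u gen by (intro exI[of _ "range u"]) auto
qed

text \<open>Induction on a finite set \<open>S\<close> that generates the maximal ideal
  \<open>m\<close> together with \<open>J\<close>. The last hypothesis encodes
  \<open>m = J + m^2\<close>. The induction hypothesis for \<open>J + (u)\<close> gives
  \<open>m = J + (u)\<close>; hence \<open>m^2\<close> lies in \<open>J + m u\<close>, so
  \<open>u\<close> itself does, and a unit \<open>1 - b\<close> brings \<open>u\<close> into
  \<open>J\<close>.\<close>

lemma nakayama_finite:
  assumes p: "p \<in> V" and "finite S" "S \<subseteq> max_ideal V p" "germ_ideal V p J" "J \<subseteq> max_ideal V p"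
    and "\<And>K. germ_ideal V p K \<Longrightarrow> J \<union> S \<subseteq> K \<Longrightarrow> max_ideal V p \<subseteq> K"
    and "\<And>K. germ_ideal V p K \<Longrightarrow> J \<subseteq> K \<Longrightarrow>
      \<forall>f\<in>max_ideal V p. \<forall>g\<in>max_ideal V p. f * g \<in> K \<Longrightarrow> max_ideal V p \<subseteq> K"
  shows "max_ideal V p \<subseteq> J"
  using assms(2-)
proof (induction S arbitrary: J rule: finite_induct)
  case empty
  \<comment> \<open>With no generator left, \<open>J\<close> itself serves as
    \<open>K\<close>.\<close>
  then show ?case by simp
next
  case (insert u S)
  note J = \<open>germ_ideal V p J\<close>
  note m = germ_ideal_max_ideal[of V p]
  have u: "u \<in> max_ideal V p" using insert.prems(1) by simp
  have u': "u \<in> local_ring V p" by (rule germ_idealD(1)[OF m u])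
  have one: "1 \<in> local_ring V p" using const_in_local_ring[OF p, of 1] by (simp add: one_fun_def)
  let ?J = "adjoin J (local_ring V p) u"
  have J': "germ_ideal V p ?J" by (rule germ_ideal_adjoin[OF J germ_ideal_local_ring p u'])
  have JJ: "J \<subseteq> ?J" by (rule germ_ideal_subset_adjoin[OF germ_ideal_local_ring p])
  have uJ: "u \<in> ?J" using germ_ideal_zero[OF J p] one by (rule adjoinI) simp
  have mJ: "max_ideal V p \<subseteq> ?J"
  proof (rule insert.IH)
    show "S \<subseteq> max_ideal V p" using insert.prems(1) by simp
    show "germ_ideal V p ?J" by (rule J')
    show "?J \<subseteq> max_ideal V p"
    proof
      fix f assume "f \<in> ?J"
      then obtain j a where *: "f = j + a * u" "j \<in> J" "a \<in> local_ring V p" by (rule adjoinE)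
      have "j \<in> max_ideal V p" using insert.prems(3) *(2) by (rule subsetD)
      then show "f \<in> max_ideal V p"
        unfolding *(1) using germ_idealD(4)[OF m *(3) u] by (rule germ_idealD(3)[OF m])
    qed
    show "max_ideal V p \<subseteq> K" if "germ_ideal V p K" "?J \<union> S \<subseteq> K" for K
      using that(1)
    proof (rule insert.prems(4))
      show "J \<union> insert u S \<subseteq> K" using that(2) JJ uJ by blast
    qed
    show "max_ideal V p \<subseteq> K" if "germ_ideal V p K" "?J \<subseteq> K"
      "\<forall>f\<in>max_ideal V p. \<forall>g\<in>max_ideal V p. f * g \<in> K" for K
      using that(1) subset_trans[OF JJ that(2)] that(3) by (rule insert.prems(5))
  qed
  \<comment> \<open>The decisive use of \<open>m = J + m^2\<close>: writing
    \<open>g = j + a u\<close> gives \<open>f g = f j + (a f) u\<close> with \<open>a f\<close> in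
    \<open>m\<close>.\<close>
  have "max_ideal V p \<subseteq> adjoin J (max_ideal V p) u"
  proof (rule insert.prems(5))
    show "germ_ideal V p (adjoin J (max_ideal V p) u)" by (rule germ_ideal_adjoin[OF J m p u'])
    show "J \<subseteq> adjoin J (max_ideal V p) u" by (rule germ_ideal_subset_adjoin[OF m p])
    show "\<forall>f\<in>max_ideal V p. \<forall>g\<in>max_ideal V p. f * g \<in> adjoin J (max_ideal V p) u"
    proof (intro ballI)
      fix f g assume f: "f \<in> max_ideal V p" and "g \<in> max_ideal V p"
      then have "g \<in> ?J" using mJ by blast
      then obtain j a where *: "g = j + a * u" "j \<in> J" "a \<in> local_ring V p" by (rule adjoinE)
      show "f * g \<in> adjoin J (max_ideal V p) u"
        using germ_idealD(4)[OF J germ_idealD(1)[OF m f] *(2)] germ_idealD(4)[OF m *(3) f]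
        by (rule adjoinI) (simp add: * algebra_simps)
    qed
  qed
  then have "u \<in> adjoin J (max_ideal V p) u" using u by (rule subsetD)
  then obtain j b where *: "u = j + b * u" "j \<in> J" "b \<in> max_ideal V p" by (rule adjoinE)
  \<comment> \<open>Since \<open>b\<close> vanishes at \<open>p\<close>, \<open>1 - b\<close> is a
    unit, and \<open>(1 - b) u = j\<close> can be solved for \<open>u\<close>.\<close>
  let ?c = "1 - b"
  let ?v = "\<lambda>q. inverse (?c q)"
  have c: "?c \<in> local_ring V p" by (rule local_ring_diff[OF p one germ_idealD(1)[OF m *(3)]])
  have cp: "?c p \<noteq> 0" using *(3) by (simp add: max_ideal_def)
  note v = local_ring_inverse[OF c cp]
  have vj: "?v * j \<in> J" by (rule germ_idealD(4)[OF J v(1) *(2)])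
  \<comment> \<open>\<open>u\<close> and \<open>?v * j\<close> agree only as germs; their difference
    is in \<open>J\<close> because germ ideals contain all representatives of zero.\<close>
  have "u - ?v * j \<in> J"
  proof (rule germ_idealD(2)[OF J])
    show "u - ?v * j \<in> local_ring V p" by (rule local_ring_diff[OF p u' germ_idealD(1)[OF J vj]])
    have j: "j q = u q - b q * u q" for q using fun_cong[OF *(1), of q] by (simp add: algebra_simps)
    show "germ_eq V p (u - ?v * j) 0" using v(2) v(2)
    proof (rule germ_eq_cong)
      fix q assume "(?c * ?v) q = 1"
      then have "(1 - b q) * inverse (1 - b q) = 1" by simp
      moreover have "(u - ?v * j) q = u q - ((1 - b q) * inverse (1 - b q)) * u q"
        by (simp add: j algebra_simps)
      ultimately show "(u - ?v * j) q = 0 q" by simp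
    qed
  qed
  then have "(u - ?v * j) + ?v * j \<in> J" using vj by (rule germ_idealD(3)[OF J])
  then have "u \<in> J" by simp
  then have "?J \<subseteq> J" using germ_idealD(3,4)[OF J] by (auto elim!: adjoinE)
  then show ?case using mJ by simp
qed

text \<open>Here \<open>K\<close> ranges over vector subspaces, among which are the germ ideals.
  This is the form needed for the contrapositive: a vector outside a subspace is detected by a
  linear functional.\<close>

lemma nakayama:
  assumes p: "p \<in> V" and J: "germ_ideal V p J" "J \<subseteq> max_ideal V p"
    and "\<And>K. fun_vs.subspace K \<Longrightarrow> J \<subseteq> K \<Longrightarrow>
      (\<And>f g. f \<in> max_ideal V p \<Longrightarrow> g \<in> max_ideal V p \<Longrightarrow> f * g \<in> K) \<Longrightarrow> max_ideal V p \<subseteq> K"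
  shows "max_ideal V p \<subseteq> J"
proof -
  obtain S where S: "finite S" "S \<subseteq> max_ideal V p"
    "\<forall>J. germ_ideal V p J \<and> S \<subseteq> J \<longrightarrow> max_ideal V p \<subseteq> J"
    using max_ideal_generators[OF p] by (elim exE conjE)
  show ?thesis
  proof (rule nakayama_finite[OF p S(1,2) J])
    show "max_ideal V p \<subseteq> K" if "germ_ideal V p K" "J \<union> S \<subseteq> K" for K
      using S(3)[THEN spec[of _ K]] that by simp
    show "max_ideal V p \<subseteq> K" if "germ_ideal V p K" "J \<subseteq> K"
      "\<forall>f\<in>max_ideal V p. \<forall>g\<in>max_ideal V p. f * g \<in> K" for K
      using assms(4)[OF germ_ideal_subspace[OF that(1) p] that(2)] that(3) by simp
  qed
qed


section \<open>Tangent directions and transversality\<close>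

lemma tangent_spaceD:
  assumes "\<delta> \<in> tangent_space V p"
  shows "f \<notin> local_ring V p \<Longrightarrow> \<delta> f = 0"
    and "f \<in> local_ring V p \<Longrightarrow> g \<in> local_ring V p \<Longrightarrow> germ_eq V p f g \<Longrightarrow> \<delta> f = \<delta> g"
    and "f \<in> local_ring V p \<Longrightarrow> g \<in> local_ring V p \<Longrightarrow> \<delta> (f + g) = \<delta> f + \<delta> g"
    and "f \<in> local_ring V p \<Longrightarrow> g \<in> local_ring V p \<Longrightarrow> \<delta> (f * g) = f p * \<delta> g + g p * \<delta> f"
    and "f \<in> local_ring V p \<Longrightarrow> \<delta> (\<lambda>q. c * f q) = c * \<delta> f"
proof -
  note \<delta> = assms[unfolded tangent_space_def mem_Collect_eq]
  note alg = \<delta>[THEN conjunct2, THEN conjunct1, THEN bspec, THEN bspec]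
  show "f \<notin> local_ring V p \<Longrightarrow> \<delta> f = 0" using \<delta>[THEN conjunct1] by simp
  show "f \<in> local_ring V p \<Longrightarrow> g \<in> local_ring V p \<Longrightarrow> germ_eq V p f g \<Longrightarrow> \<delta> f = \<delta> g"
    using alg[of f g] by blast
  show "f \<in> local_ring V p \<Longrightarrow> g \<in> local_ring V p \<Longrightarrow> \<delta> (f + g) = \<delta> f + \<delta> g"
    using alg[of f g] by blast
  show "f \<in> local_ring V p \<Longrightarrow> g \<in> local_ring V p \<Longrightarrow> \<delta> (f * g) = f p * \<delta> g + g p * \<delta> f"
    using alg[of f g] by blast
  show "f \<in> local_ring V p \<Longrightarrow> \<delta> (\<lambda>q. c * f q) = c * \<delta> f"
    using \<delta>[THEN conjunct2, THEN conjunct2] by simp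
qed

text \<open>A basis of \<open>Q\<close> stays independent when \<open>h\<close> is added, so a
  linear map may be prescribed as 0 on the basis and 1 at \<open>h\<close>.\<close>

lemma separating_functional:
  fixes Q :: "('x \<Rightarrow> 'k::field) set"
  assumes Q: "fun_vs.subspace Q" and h: "h \<notin> Q"
  shows "\<exists>\<phi>. (\<forall>f g. \<phi> (f + g) = \<phi> f + \<phi> g) \<and> (\<forall>c f. \<phi> (\<lambda>x. c * f x) = c * \<phi> f) \<and>
    (\<forall>f\<in>Q. \<phi> f = 0) \<and> \<phi> h = (1::'k)"
proof -
  interpret vector_space_pair "\<lambda>(c::'k) (f::'x \<Rightarrow> 'k) x. c * f x" "(*) :: 'k \<Rightarrow> 'k \<Rightarrow> 'k"
    by (rule vector_space_pair.intro[OF fun_vs.vector_space_axioms vector_space_over_itself.vector_space_axioms])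
  obtain B where B: "B \<subseteq> Q" "fun_vs.independent B" "Q \<subseteq> fun_vs.span B"
    by (rule fun_vs.maximal_independent_subset)
  have span: "fun_vs.span B = Q" using B(3) fun_vs.span_minimal[OF B(1) Q] by (intro equalityI)
  have "fun_vs.independent (insert h B)"
    by (rule fun_vs.independent_insertI) (use B(2) h span in simp_all)
  from linear_independent_extend[OF this, of "\<lambda>x. if x = h then 1 else 0"]
  obtain \<phi> where \<phi>: "Vector_Spaces.linear (\<lambda>(c::'k) (f::'x \<Rightarrow> 'k) x. c * f x) (*) \<phi>"
    "\<forall>x\<in>insert h B. \<phi> x = (if x = h then 1 else 0)"
    by (elim exE conjE)
  have 0: "\<phi> f = 0" if "f \<in> Q" for f
  proof (rule linear_eq_0_on_span[OF \<phi>(1)])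
    show "f \<in> fun_vs.span B" using that span by simp
    show "\<phi> x = 0" if "x \<in> B" for x
    proof -
      have "x \<noteq> h" using that B(1) h by blast
      then show ?thesis using \<phi>(2)[THEN bspec, of x] that by simp
    qed
  qed
  show ?thesis
  proof (intro exI[of _ \<phi>] conjI allI ballI)
    show "\<phi> h = 1" using \<phi>(2) by simp
  qed (simp_all only: linear_add[OF \<phi>(1)] linear_scale[OF \<phi>(1)] 0)
qed

text \<open>The identification of tangent vectors with functionals on \<open>m/m^2\<close>: a
  functional killing \<open>K\<close>, which contains \<open>m^2\<close>, yields a point derivation.
  The hypothesis \<open>null\<close> makes it depend only on germs.\<close>

lemma tangent_vector_exists:
  assumes p: "p \<in> V" and K: "fun_vs.subspace K"
    and mm: "\<And>f g. f \<in> max_ideal V p \<Longrightarrow> g \<in> max_ideal V p \<Longrightarrow> f * g \<in> K"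
    and null: "\<And>f. f \<in> local_ring V p \<Longrightarrow> germ_eq V p f 0 \<Longrightarrow> f \<in> K"
    and h: "h \<in> max_ideal V p" "h \<notin> K"
  shows "\<exists>\<delta>\<in>tangent_space V p. \<delta> h \<noteq> 0 \<and> (\<forall>f\<in>K \<inter> max_ideal V p. \<delta> f = 0)"
proof -
  obtain \<phi> where add: "\<And>f g. \<phi> (f + g) = \<phi> f + \<phi> g" and scale: "\<And>c f. \<phi> (\<lambda>x. c * f x) = c * \<phi> f"
    and K0: "\<And>f. f \<in> K \<Longrightarrow> \<phi> f = 0" and h1: "\<phi> h = 1"
    using separating_functional[OF K h(2)] by metis
  \<comment> \<open>Subtracting the value at \<open>p\<close> moves \<open>f\<close> into
    \<open>m\<close>; the value 0 off the local ring is the convention of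
    \<open>tangent_space\<close>.\<close>
  define \<delta> where "\<delta> f = (if f \<in> local_ring V p then \<phi> (\<lambda>q. f q - f p) else 0)" for f
  have \<delta>m: "\<delta> f = \<phi> f" if "f \<in> max_ideal V p" for f
    using that by (simp add: \<delta>_def max_ideal_def)
  have m: "(\<lambda>q. f q - f p) \<in> max_ideal V p" if "f \<in> local_ring V p" for f
    using local_ring_minus_const[OF p that] by (simp add: max_ideal_def)
  have "\<delta> \<in> tangent_space V p"
    unfolding tangent_space_def
  proof (intro CollectI conjI allI ballI impI)
    fix f assume "f \<notin> local_ring V p"
    then show "\<delta> f = 0" by (simp add: \<delta>_def)
  next
    fix f g assume fg: "f \<in> local_ring V p" "g \<in> local_ring V p"
    show "\<delta> (f + g) = \<delta> f + \<delta> g"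
    proof -
      have "(\<lambda>q. (f + g) q - (f + g) p) = (\<lambda>q. f q - f p) + (\<lambda>q. g q - g p)"
        by (auto simp: algebra_simps)
      then show ?thesis using fg add by (simp add: \<delta>_def local_ring_add)
    qed
    show "\<delta> (f * g) = f p * \<delta> g + g p * \<delta> f"
    proof -
      \<comment> \<open>The first two summands give the Leibniz rule; the third is a product of two
        elements of \<open>m\<close> and is killed.\<close>
      have "(\<lambda>q. (f * g) q - (f * g) p) =
        (\<lambda>q. f p * (g q - g p)) + (\<lambda>q. g p * (f q - f p)) + (\<lambda>q. f q - f p) * (\<lambda>q. g q - g p)"
        by (auto simp: algebra_simps)
      moreover have "\<phi> ((\<lambda>q. f q - f p) * (\<lambda>q. g q - g p)) = 0" using K0 mm m fg by blast
      moreover have "\<delta> (f * g) = \<phi> (\<lambda>q. (f * g) q - (f * g) p)"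
        using fg by (simp only: \<delta>_def local_ring_mult if_True)
      ultimately show ?thesis using fg by (simp only: add scale \<delta>_def if_True add_0_right)
    qed
    assume eq: "germ_eq V p f g"
    have "f p = g p" using germ_eq_at[OF eq] .
    then have "(\<lambda>q. f q - f p) = (\<lambda>q. g q - g p) + (f - g)" by auto
    moreover have "germ_eq V p (f - g) 0" using eq eq by (rule germ_eq_cong) auto
    ultimately show "\<delta> f = \<delta> g" using fg add K0[OF null] local_ring_diff[OF p] by (simp add: \<delta>_def)
  next
    fix c f assume f: "f \<in> local_ring V p"
    have "(\<lambda>q. c * f q - c * f p) = (\<lambda>q. c * (f q - f p))" by (auto simp: algebra_simps)
    then show "\<delta> (\<lambda>q. c * f q) = c * \<delta> f"
      using f scale local_ring_scale[OF p f] by (simp add: \<delta>_def)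
  qed
  then show ?thesis using \<delta>m h h1 K0 by (intro bexI[of _ \<delta>]) auto
qed

text \<open>The local ring of \<open>C\<close> is that of \<open>V\<close> modulo the ideal of
  \<open>C\<close>, so a derivation killing this ideal descends. It is evaluated on germs of
  \<open>C\<close> through lifts to \<open>V\<close>.\<close>

lemma tangent_direction_extend:
  assumes C: "C \<subseteq> V" "p \<in> C" and \<delta>: "\<delta> \<in> tangent_direction V C p"
  shows "\<exists>\<epsilon>\<in>tangent_space C p. \<forall>f\<in>local_ring V p. \<epsilon> f = \<delta> f"
proof -
  have p: "p \<in> V" using C by auto
  have \<delta>T: "\<delta> \<in> tangent_space V p" and \<delta>0: "\<And>f. f \<in> local_ring V p \<Longrightarrow> germ_eq C p f 0 \<Longrightarrow> \<delta> f = 0"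
    using \<delta> ideal_at_eq[OF C] by (auto simp: tangent_direction_def)
  note T = tangent_spaceD[OF \<delta>T]
  define l where "l f = (SOME g. g \<in> local_ring V p \<and> germ_eq C p f g)" for f
  have l: "l f \<in> local_ring V p" "germ_eq C p f (l f)" if "f \<in> local_ring C p" for f
    using local_ring_lift[OF that C] unfolding l_def by (metis (mono_tags, lifting) someI)+
  define \<epsilon> where "\<epsilon> f = (if f \<in> local_ring C p then \<delta> (l f) else 0)" for f
  \<comment> \<open>Independence of the lift: two lifts differ by an element of the ideal of
    \<open>C\<close>.\<close>
  have \<epsilon>: "\<epsilon> f = \<delta> g" if f: "f \<in> local_ring C p" "g \<in> local_ring V p" "germ_eq C p f g" for f g
  proof -
    have "germ_eq C p (l f - g) 0" using l(2)[OF f(1)] f(3) by (rule germ_eq_cong) auto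
    moreover have d: "l f - g \<in> local_ring V p" using local_ring_diff[OF p] l f by blast
    ultimately have "\<delta> (l f - g) = 0" using \<delta>0 by blast
    moreover have "\<delta> (l f) = \<delta> ((l f - g) + g)" by simp
    ultimately show ?thesis using T(3)[OF d f(2)] f by (simp add: \<epsilon>_def)
  qed
  have "\<epsilon> \<in> tangent_space C p"
    unfolding tangent_space_def
  proof (intro CollectI conjI allI ballI impI)
    fix f assume "f \<notin> local_ring C p"
    then show "\<epsilon> f = 0" by (simp add: \<epsilon>_def)
  next
    fix f g assume fg: "f \<in> local_ring C p" "g \<in> local_ring C p"
    note lf = l[OF fg(1)] and lg = l[OF fg(2)]
    have 1: "\<epsilon> f = \<delta> (l f)" "\<epsilon> g = \<delta> (l g)" using \<epsilon> fg lf lg by auto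
    have "germ_eq C p (f + g) (l f + l g)" using lf(2) lg(2) by (rule germ_eq_cong) auto
    then have "\<epsilon> (f + g) = \<delta> (l f + l g)" using \<epsilon> fg lf lg local_ring_add by blast
    then show "\<epsilon> (f + g) = \<epsilon> f + \<epsilon> g" using 1 T(3) lf lg by simp
    have "germ_eq C p (f * g) (l f * l g)" using lf(2) lg(2) by (rule germ_eq_cong) auto
    then have "\<epsilon> (f * g) = \<delta> (l f * l g)" using \<epsilon> fg lf lg local_ring_mult by blast
    then show "\<epsilon> (f * g) = f p * \<epsilon> g + g p * \<epsilon> f"
      using 1 T(4) lf lg germ_eq_at[OF lf(2)] germ_eq_at[OF lg(2)] by simp
    assume eq: "germ_eq C p f g"
    have "germ_eq C p f (l g)" using eq lg(2) by (rule germ_eq_cong) auto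
    then show "\<epsilon> f = \<epsilon> g" using \<epsilon> fg lg 1 by metis
  next
    fix c f assume f: "f \<in> local_ring C p"
    note lf = l[OF f]
    have "germ_eq C p (\<lambda>q. c * f q) (\<lambda>q. c * l f q)" using lf(2) lf(2) by (rule germ_eq_cong) auto
    then have "\<epsilon> (\<lambda>q. c * f q) = \<delta> (\<lambda>q. c * l f q)"
      using \<epsilon> local_ring_scale[OF C(2) f] local_ring_scale[OF p lf(1)] by blast
    then show "\<epsilon> (\<lambda>q. c * f q) = c * \<epsilon> f" using T(5) lf \<epsilon>[OF f lf] by simp
  qed
  moreover have "\<epsilon> f = \<delta> f" if "f \<in> local_ring V p" for f
    using \<epsilon>[OF local_ring_restrict[OF that C] that germ_eq_refl[OF C(2)]] .
  ultimately show ?thesis by blast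
qed

lemma tangent_direction_scale:
  assumes "p \<in> V" "\<delta> \<in> tangent_direction V C p"
  shows "(\<lambda>f. c * \<delta> f) \<in> tangent_direction V C p"
proof -
  have \<delta>T: "\<delta> \<in> tangent_space V p" using assms by (simp add: tangent_direction_def)
  note T = tangent_spaceD[OF \<delta>T]
  have "(\<lambda>f. c * \<delta> f) \<in> tangent_space V p"
    unfolding tangent_space_def
  proof (intro CollectI conjI allI ballI impI)
    fix f g assume fg: "f \<in> local_ring V p" "g \<in> local_ring V p"
    show "c * \<delta> (f + g) = c * \<delta> f + c * \<delta> g" using T(3)[OF fg] by (simp add: algebra_simps)
    show "c * \<delta> (f * g) = f p * (c * \<delta> g) + g p * (c * \<delta> f)" using T(4)[OF fg] by (simp add: algebra_simps)
    show "c * \<delta> f = c * \<delta> g" if "germ_eq V p f g" using T(2)[OF fg that] by simp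
  qed (simp_all add: T(1,5))
  then show ?thesis using assms(2) by (simp add: tangent_direction_def)
qed

text \<open>Both vectors descend to the one-dimensional tangent space of \<open>C\<close>, where
  they are multiples \<open>x\<close> and \<open>y\<close> of one vector \<open>b\<close>; the
  factor is \<open>y / x\<close>.\<close>

lemma tangent_direction_proportional:
  assumes C: "C \<subseteq> V" "p \<in> C" and dim: "fun_vs.dim (tangent_space C p) = 1"
    and \<delta>: "\<delta> \<in> tangent_direction V C p" "\<delta> h \<noteq> 0" and \<eta>: "\<eta> \<in> tangent_direction V C p"
  shows "\<exists>c. \<eta> = (\<lambda>f. c * \<delta> f)"
proof -
  have T: "\<delta> \<in> tangent_space V p" "\<eta> \<in> tangent_space V p"
    using \<delta> \<eta> by (auto simp: tangent_direction_def)
  obtain \<delta>' where \<delta>': "\<delta>' \<in> tangent_space C p" "\<And>f. f \<in> local_ring V p \<Longrightarrow> \<delta>' f = \<delta> f"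
    using tangent_direction_extend[OF C \<delta>(1)] by blast
  obtain \<eta>' where \<eta>': "\<eta>' \<in> tangent_space C p" "\<And>f. f \<in> local_ring V p \<Longrightarrow> \<eta>' f = \<eta> f"
    using tangent_direction_extend[OF C \<eta>] by blast
  obtain B where B: "card B = 1" "tangent_space C p \<subseteq> fun_vs.span B"
    using fun_vs.basis_exists[of "tangent_space C p"] dim by metis
  then obtain b where "B = {b}" by (auto simp: card_1_singleton_iff)
  then have span: "tangent_space C p \<subseteq> range (\<lambda>c f. c * b f)"
    using B fun_vs.span_singleton[of b] by simp
  obtain x where x: "\<delta>' = (\<lambda>f. x * b f)" using span \<delta>'(1) by blast
  obtain y where y: "\<eta>' = (\<lambda>f. y * b f)" using span \<eta>'(1) by blast
  \<comment> \<open>A nonzero value at \<open>h\<close> puts \<open>h\<close> in the local ring,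
    where \<open>\<delta>'\<close> and \<open>\<delta>\<close> agree; this excludes
    \<open>x = 0\<close>.\<close>
  have "h \<in> local_ring V p" using \<delta>(2) tangent_spaceD(1)[OF T(1)] by blast
  then have "x \<noteq> 0" using x \<delta>'(2) \<delta>(2) by fastforce
  have "\<eta> f = y / x * \<delta> f" for f
  proof (cases "f \<in> local_ring V p")
    case True
    then have "\<delta> f = x * b f" "\<eta> f = y * b f" using \<delta>'(2) \<eta>'(2) x y by metis+
    then show ?thesis using \<open>x \<noteq> 0\<close> by simp
  next
    case False
    then show ?thesis using tangent_spaceD(1)[OF T(1)] tangent_spaceD(1)[OF T(2)] by simp
  qed
  then show ?thesis by blast
qed

lemma transversal_ideal_sum:
  assumes C: "C \<subseteq> V" "p \<in> C" "fun_vs.dim (tangent_space C p) = 1"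
    and D: "D \<subseteq> V" "p \<in> D" "fun_vs.dim (tangent_space D p) = 1"
    and ne: "tangent_direction V C p \<noteq> tangent_direction V D p"
  shows "{f + g | f g. f \<in> ideal_at V C p \<and> g \<in> ideal_at V D p} = max_ideal V p" (is "?J = _")
proof
  have p: "p \<in> V" using C by auto
  note IC = ideal_at_germ_ideal[OF C(1,2)] and ID = ideal_at_germ_ideal[OF D(1,2)]
  have J: "germ_ideal V p ?J" by (rule germ_ideal_sum[OF IC ID p])
  have CJ: "ideal_at V C p \<subseteq> ?J"
  proof
    fix f assume "f \<in> ideal_at V C p"
    moreover have "f = f + 0" by simp
    ultimately show "f \<in> ?J" using germ_ideal_zero[OF ID p] by blast
  qed
  have DJ: "ideal_at V D p \<subseteq> ?J"
  proof
    fix f assume "f \<in> ideal_at V D p"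
    moreover have "f = 0 + f" by simp
    ultimately show "f \<in> ?J" using germ_ideal_zero[OF IC p] by blast
  qed
  have Cp: "f p = 0" if "f \<in> ideal_at V C p" for f
    using that ideal_at_eq[OF C(1,2)] germ_eq_at[of C p f 0] by simp
  have Dp: "f p = 0" if "f \<in> ideal_at V D p" for f
    using that ideal_at_eq[OF D(1,2)] germ_eq_at[of D p f 0] by simp
  show Jm: "?J \<subseteq> max_ideal V p"
  proof
    fix f assume f: "f \<in> ?J"
    then obtain a b where "f = a + b" "a \<in> ideal_at V C p" "b \<in> ideal_at V D p" by blast
    then have "f p = 0" using Cp[of a] Dp[of b] by simp
    then show "f \<in> max_ideal V p" using germ_idealD(1)[OF J f] by (simp add: max_ideal_def)
  qed
  show "max_ideal V p \<subseteq> ?J"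
  proof (rule nakayama[OF p J Jm], rule ccontr)
    fix K assume K: "fun_vs.subspace K" "?J \<subseteq> K"
      "\<And>f g. f \<in> max_ideal V p \<Longrightarrow> g \<in> max_ideal V p \<Longrightarrow> f * g \<in> K"
    assume "\<not> max_ideal V p \<subseteq> K"
    then obtain h where h: "h \<in> max_ideal V p" "h \<notin> K" by blast
    have null: "f \<in> K" if "f \<in> local_ring V p" "germ_eq V p f 0" for f
      using germ_idealD(2)[OF J that] K(2) by blast
    obtain \<delta> where \<delta>: "\<delta> \<in> tangent_space V p" "\<delta> h \<noteq> 0" "\<And>f. f \<in> K \<inter> max_ideal V p \<Longrightarrow> \<delta> f = 0"
      using tangent_vector_exists[OF p K(1) K(3) null h] by blast
    have \<delta>J: "\<delta> f = 0" if "f \<in> ?J" for f using that \<delta>(3) K(2) Jm by blast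
    \<comment> \<open>Killing the sum, \<open>\<delta>\<close> kills both ideals and so is tangent
      to both curves.\<close>
    have \<delta>C: "\<delta> \<in> tangent_direction V C p" and \<delta>D: "\<delta> \<in> tangent_direction V D p"
      unfolding tangent_direction_def using \<delta>(1) \<delta>J CJ DJ by blast+
    have "tangent_direction V C p \<subseteq> tangent_direction V D p"
      \<comment> \<open>Every vector tangent to \<open>C\<close> is a multiple of
        \<open>\<delta>\<close>, and multiples of \<open>\<delta>\<close> are tangent to
        \<open>D\<close>.\<close>
      using tangent_direction_proportional[OF C \<delta>C \<delta>(2)] tangent_direction_scale[OF p \<delta>D] by blast
    moreover have "tangent_direction V D p \<subseteq> tangent_direction V C p"
      using tangent_direction_proportional[OF D \<delta>D \<delta>(2)] tangent_direction_scale[OF p \<delta>C] by blast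
    ultimately show False using ne by blast
  qed
qed

text \<open>The residue field is the ground field: \<open>f = (f - f(p)) + f(p)\<close>, so the
  constant 1 suffices. It cannot be omitted, because everything in the span of the maximal ideal
  vanishes at \<open>p\<close>.\<close>

lemma quot_dim_max_ideal:
  assumes p: "p \<in> V"
  shows "quot_dim (local_ring V p) (max_ideal V p) = 1"
proof -
  let ?P = "\<lambda>n. \<exists>S. S \<subseteq> local_ring V p \<and> finite S \<and> card S = n \<and> local_ring V p \<subseteq> fun_vs.span (max_ideal V p \<union> S)"
  have one: "(\<lambda>_. 1) \<in> local_ring V p" by (rule const_in_local_ring[OF p])
  have "?P 1"
  proof (intro exI[of _ "{\<lambda>_. 1}"] conjI subsetI)
    fix f assume f: "f \<in> local_ring V p"
    let ?B = "max_ideal V p \<union> {\<lambda>_. 1}"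
    have "(\<lambda>q. f q - f p) \<in> fun_vs.span ?B"
      using local_ring_minus_const[OF p f] by (intro fun_vs.span_base) (simp add: max_ideal_def)
    moreover have "(\<lambda>q. f p * 1) \<in> fun_vs.span ?B"
      by (rule fun_vs.span_scale) (simp add: fun_vs.span_base)
    ultimately have "(\<lambda>q. f q - f p) + (\<lambda>q. f p * 1) \<in> fun_vs.span ?B" by (rule fun_vs.span_add)
    moreover have "(\<lambda>q. f q - f p) + (\<lambda>q. f p * 1) = f" by auto
    ultimately show "f \<in> fun_vs.span ?B" by simp
  qed (use one in auto)
  moreover have "1 \<le> n" if n: "?P n" for n
  proof (rule ccontr)
    assume "\<not> 1 \<le> n"
    obtain S where S: "finite S" "card S = n" "local_ring V p \<subseteq> fun_vs.span (max_ideal V p \<union> S)"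
      using n by blast
    have "card S = 0" using S(2) \<open>\<not> 1 \<le> n\<close> by linarith
    then have "S = {}" using S(1) by simp
    then have sp: "local_ring V p \<subseteq> fun_vs.span (max_ideal V p)" using S(3) by simp
    have "fun_vs.subspace {f. f p = 0}" by (auto simp: fun_vs.subspace_def)
    then have "fun_vs.span (max_ideal V p) \<subseteq> {f. f p = 0}"
      by (intro fun_vs.span_minimal) (auto simp: max_ideal_def)
    with sp one show False by auto
  qed
  ultimately show ?thesis unfolding quot_dim_def by (rule Least_equality)
qed

text \<open>Smooth curves have one-dimensional tangent spaces, so at the only common point the two
  ideals add up to the maximal ideal and the local contribution is 1.\<close>

lemma transversal_intersection_number:
  assumes C: "smooth_rational_curve X C" and D: "smooth_rational_curve X D" and "C \<noteq> D"
    and CD: "C \<inter> D = {p}" and ne: "tangent_direction X C p \<noteq> tangent_direction X D p"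
  shows "intersection_number X C D = 1"
proof -
  have p: "p \<in> C" "p \<in> D" using CD by auto
  have "C \<subseteq> X" "D \<subseteq> X" "fun_vs.dim (tangent_space C p) = 1" "fun_vs.dim (tangent_space D p) = 1"
    using C D p by (auto simp: smooth_rational_curve_def curves_in_def smooth_var_def)
  then have "local_intersection X C D p = 1"
    unfolding local_intersection_def using transversal_ideal_sum[of C X p D] p ne quot_dim_max_ideal[of p X]
    by auto
  then show ?thesis using \<open>C \<noteq> D\<close> CD by (simp add: intersection_number_def proper_intersection_def)
qed


section \<open>Dynkin diagrams on at most three vertices\<close>

text \<open>The edge condition concerns distinct vertices only, so self-intersection does not
  enter.\<close>

lemma ade_graph_singleton: "ade_graph {x} w {#DynA 1#}"
proof -
  have "{(i, v). i < length [DynA 1] \<and> v < dynkin_rank ([DynA 1] ! i)} = {(0, 0)}" by auto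
  then have "bij_betw (\<lambda>_. (0, 0)) {x} {(i, v). i < length [DynA 1] \<and> v < dynkin_rank ([DynA 1] ! i)}"
    by (simp add: bij_betw_def)
  then show ?thesis unfolding ade_graph_def
    by (intro conjI exI[of _ "[DynA 1]"] exI[of _ "\<lambda>_. (0, 0)"]) auto
qed

lemma ade_graph_pair:
  assumes "x \<noteq> y" "w x y = 1" "w y x = 1"
  shows "ade_graph {x, y} w {#DynA 2#}"
proof -
  let ?\<phi> = "\<lambda>z. if z = x then (0, 0) else (0, 1) :: nat \<times> nat"
  have "{(i, v). i < length [DynA 2] \<and> v < dynkin_rank ([DynA 2] ! i)} = {(0, 0), (0, 1)}" by auto
  then have "bij_betw ?\<phi> {x, y} {(i, v). i < length [DynA 2] \<and> v < dynkin_rank ([DynA 2] ! i)}"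
    using assms(1) by (auto simp: bij_betw_def inj_on_def)
  then show ?thesis unfolding ade_graph_def
    using assms by (intro conjI exI[of _ "[DynA 2]"] exI[of _ ?\<phi>]) (auto simp: dynkin_edge_def)
qed

text \<open>Validity excludes small ranks, where the truncated subtractions could break the
  inequality.\<close>

lemma dynkin_arrow_less: "valid_dynkin t \<Longrightarrow> dynkin_arrow t i j \<Longrightarrow> i < j"
  by (cases t) auto

text \<open>The orientation makes each diagram a rooted tree, in which a vertex has at most one
  parent.\<close>

lemma dynkin_arrow_unique: "dynkin_arrow t i k \<Longrightarrow> dynkin_arrow t j k \<Longrightarrow> i = j"
  by (cases t) auto

text \<open>The largest vertex of a triangle would have the other two, which are distinct, as
  parents.\<close>

lemma dynkin_triangle_free:
  assumes t: "valid_dynkin t" and "dynkin_edge t a b" "dynkin_edge t a c" "dynkin_edge t b c"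
  shows False
  using assms(2-4) unfolding dynkin_edge_def
  by (elim disjE; metis dynkin_arrow_less[OF t] dynkin_arrow_unique less_trans less_irrefl)

lemma ade_graph_triangle_free:
  assumes "ade_graph V w T" "{x, y, z} \<subseteq> V" "distinct [x, y, z]"
    "w x y = 1" "w x z = 1" "w y z = 1"
  shows False
proof -
  obtain ts \<phi> where valid: "\<forall>t\<in>#T. valid_dynkin t" and ts: "mset ts = T"
    and bij: "bij_betw \<phi> V {(i, v). i < length ts \<and> v < dynkin_rank (ts ! i)}"
    and w: "\<forall>x\<in>V. \<forall>y\<in>V. x \<noteq> y \<longrightarrow> w x y =
      (if fst (\<phi> x) = fst (\<phi> y) \<and> dynkin_edge (ts ! fst (\<phi> x)) (snd (\<phi> x)) (snd (\<phi> y)) then 1 else 0)"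
    using assms(1) unfolding ade_graph_def by (elim conjE exE)
  have edge: "fst (\<phi> a) = fst (\<phi> b) \<and> dynkin_edge (ts ! fst (\<phi> a)) (snd (\<phi> a)) (snd (\<phi> b))"
    if "a \<in> V" "b \<in> V" "a \<noteq> b" "w a b = 1" for a b
    using bspec[OF bspec[OF w that(1)] that(2)] that(3,4) by (metis zero_neq_one)
  have V: "x \<in> V" "y \<in> V" "z \<in> V" and ne: "x \<noteq> y" "x \<noteq> z" "y \<noteq> z" using assms(2,3) by auto
  note xy = edge[OF V(1,2) ne(1) assms(4)] and xz = edge[OF V(1,3) ne(2) assms(5)]
    and yz = edge[OF V(2,3) ne(3) assms(6)]
  have "\<phi> x \<in> {(i, v). i < length ts \<and> v < dynkin_rank (ts ! i)}"
    by (rule bij_betw_apply[OF bij V(1)])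
  then have "fst (\<phi> x) < length ts" by (simp add: case_prod_beta)
  then have "ts ! fst (\<phi> x) \<in># T" unfolding ts[symmetric] by simp
  then have "valid_dynkin (ts ! fst (\<phi> x))" using valid by simp
  then show False
    \<comment> \<open>The third edge is stated in the diagram containing \<open>\<phi> y\<close>;
      folding moves it to that of \<open>\<phi> x\<close>, which is the same one.\<close>
    using conjunct2[OF xy] conjunct2[OF xz] conjunct2[OF yz, folded conjunct1[OF xy]]
    by (rule dynkin_triangle_free)
qed

section \<open>Reduced subdivisors of a type IV fiber\<close>

theorem proposition8p1:
  fixes X C1 C2 C3 :: "('k::{alg_closed_field, field_char_0}, 'n::finite) proj set"
    and g :: "('k, 'n) proj \<Rightarrow> ('k, 2) proj"
    and t :: "('k, 2) proj"
    and F :: "('k, 'n) divisor"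
  assumes "K3_surface X"
    and "elliptic_fibration X g"
    and "F = fiber X g t"
    and "kodaira_IV X F C1 C2 C3"
  shows "(\<forall>R. ADER X F R \<longrightarrow>
            (has_type X R {#DynA 1#} \<or> has_type X R {#DynA 2#}) \<and>
            (card (div_components R) = 1 \<or> card (div_components R) = 2) \<and>
            (card (div_components R) = 1 \<longrightarrow> has_type X R {#DynA 1#}) \<and>
            (card (div_components R) = 2 \<longrightarrow> has_type X R {#DynA 2#})) \<and>
         (\<exists>R. ADER X F R \<and> has_type X R {#DynA 1#}) \<and>
         (\<exists>R. ADER X F R \<and> has_type X R {#DynA 2#})"
proof -
  let ?S = "{C1, C2, C3}"
  obtain p where F: "F = prime_div C1 + prime_div C2 + prime_div C3"
    and ne: "C1 \<noteq> C2" "C1 \<noteq> C3" "C2 \<noteq> C3"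
    and m2: "\<And>C. C \<in> ?S \<Longrightarrow> smooth_rational_m2_curve X C"
    and meet: "C1 \<inter> C2 = {p}" "C1 \<inter> C3 = {p}" "C2 \<inter> C3 = {p}"
    and tan: "distinct [tangent_direction X C1 p, tangent_direction X C2 p, tangent_direction X C3 p]"
    using assms(4) unfolding kodaira_IV_def by (elim exE conjE) simp
  have rat: "smooth_rational_curve X C" if "C \<in> ?S" for C
    using m2[OF that] by (simp add: smooth_rational_m2_curve_def)
  have curve: "C \<in> curves_in X" if "C \<in> ?S" for C
    using rat[OF that] by (simp add: smooth_rational_curve_def)
  \<comment> \<open>Both orders of each pair are covered, as \<open>ade_graph\<close> tests ordered
    pairs.\<close>
  have int: "intersection_number X C D = 1" if CD: "C \<in> ?S" "D \<in> ?S" "C \<noteq> D" for C D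
  proof (rule transversal_intersection_number[OF rat[OF CD(1)] rat[OF CD(2)] CD(3)])
    show "C \<inter> D = {p}" using CD meet
      by (elim insertE emptyE) (simp_all add: Int_commute)
    show "tangent_direction X C p \<noteq> tangent_direction X D p" using CD tan
      by (elim insertE emptyE) auto
  qed
  have sing: "has_type X R {#DynA 1#}" if "div_components R = {C}" for R C
    unfolding has_type_def that by (rule ade_graph_singleton)
  have pair: "has_type X R {#DynA 2#}" if "div_components R = {C, D}" "C \<in> ?S" "D \<in> ?S" "C \<noteq> D" for R C D
    unfolding has_type_def that(1) using that int by (intro ade_graph_pair) auto
  have types: "(has_type X R {#DynA 1#} \<or> has_type X R {#DynA 2#}) \<and>
      (card (div_components R) = 1 \<or> card (div_components R) = 2) \<and>
      (card (div_components R) = 1 \<longrightarrow> has_type X R {#DynA 1#}) \<and>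
      (card (div_components R) = 2 \<longrightarrow> has_type X R {#DynA 2#})" if R: "ADER X F R" for R
  proof -
    let ?V = "div_components R"
    have sub: "?V \<subseteq> ?S"
    proof
      fix C assume "C \<in> ?V"
      then have "R C \<noteq> 0" by (simp add: div_components_def)
      moreover have "\<forall>C. R C \<in> {0, 1} \<and> R C \<le> F C" using R unfolding ADER_def by (elim conjE)
      then have "R C \<in> {0, 1} \<and> R C \<le> F C" by (rule spec)
      \<comment> \<open>A nonzero coefficient of \<open>R\<close> is 1, so \<open>F C\<close> is at
        least 1.\<close>
      ultimately have "F C \<noteq> 0" by force
      then show "C \<in> ?S" by (simp add: F prime_div_def split: if_splits)
    qed
    have "?V \<noteq> {}" using R by (simp add: ADER_def)
    moreover have "finite ?V" using sub finite_subset by blast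
    ultimately have "card ?V \<noteq> 0" by simp
    moreover have "card ?V \<le> 3" using card_mono[OF _ sub] ne by simp
    moreover have "card ?V \<noteq> 3"
    proof
      assume "card ?V = 3"
      then have "?V = ?S" using card_subset_eq[OF _ sub] ne by simp
      moreover obtain T where "ade_graph ?V (intersection_number X) T"
        using R unfolding ADER_def has_type_def by (elim conjE exE)
      ultimately show False
        using ade_graph_triangle_free[of ?V "intersection_number X" T C1 C2 C3] int ne by simp
    qed
    ultimately have 12: "card ?V = 1 \<or> card ?V = 2" by linarith
    have A1: "has_type X R {#DynA 1#}" if one: "card ?V = 1"
    proof -
      obtain C where "?V = {C}" using one by (rule card_1_singletonE)
      then show ?thesis by (rule sing)
    qed
    have A2: "has_type X R {#DynA 2#}" if two: "card ?V = 2"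
    proof -
      obtain C D where CD: "?V = {C, D}" "C \<noteq> D" using two unfolding card_2_iff by (elim exE conjE)
      show ?thesis by (rule pair[OF CD(1)]) (use sub CD in auto)
    qed
    from 12 A1 A2 show ?thesis by (elim disjE) simp_all
  qed
  \<comment> \<open>For the converse: the conditions on curves come from the components of
    \<open>F\<close>, leaving only support, coefficients and type to check.\<close>
  have ADER_I: "ADER X F R" if "div_components R \<subseteq> ?S" "div_components R \<noteq> {}"
    "\<And>C. R C \<in> {0, 1} \<and> R C \<le> F C" "has_type X R T" for R T
    unfolding ADER_def is_divisor_def
  proof (intro conjI allI ballI)
    show "finite (div_components R)" using that(1) by (rule finite_subset) simp
    show "div_components R \<subseteq> curves_in X" using that(1) curve by blast
    show "\<exists>T. has_type X R T" using that(4) by (rule exI)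
    show "smooth_rational_m2_curve X C" if "C \<in> div_components R" for C
      using m2 that \<open>div_components R \<subseteq> ?S\<close> by blast
  qed (use that in auto)
  have A1: "ADER X F (prime_div C1) \<and> has_type X (prime_div C1) {#DynA 1#}"
  proof
    have comp: "div_components (prime_div C1) = {C1}" by (simp add: div_components_def prime_div_def)
    show type: "has_type X (prime_div C1) {#DynA 1#}" by (rule sing[OF comp])
    show "ADER X F (prime_div C1)"
      by (rule ADER_I[OF _ _ _ type]) (simp_all add: comp, simp add: F prime_div_def)
  qed
  have A2: "ADER X F (prime_div C1 + prime_div C2) \<and> has_type X (prime_div C1 + prime_div C2) {#DynA 2#}"
  proof
    let ?R = "prime_div C1 + prime_div C2"
    have comp: "div_components ?R = {C1, C2}" by (auto simp: div_components_def prime_div_def)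
    show type: "has_type X ?R {#DynA 2#}" by (rule pair[OF comp]) (simp_all add: ne)
    \<comment> \<open>\<open>C1\<close> and \<open>C2\<close> being different keeps every
      coefficient of the sum at most 1.\<close>
    have "?R C \<in> {0, 1} \<and> ?R C \<le> F C" for C using ne by (simp add: F prime_div_def)
    then show "ADER X F ?R"
      by (rule ADER_I[OF _ _ _ type, rotated 2]) (simp_all add: comp)
  qed
  show ?thesis
  proof (intro conjI allI impI)
    show "\<exists>R. ADER X F R \<and> has_type X R {#DynA 1#}" by (intro exI) (rule A1)
    show "\<exists>R. ADER X F R \<and> has_type X R {#DynA 2#}" by (intro exI) (rule A2)
  qed (drule types, simp)+
qed

end
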